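(* Let $X$ be a complex vector space with $\dim_{\mathbb{C}}X\ge2$ and $Y\ne\{0\}$ a sequentially complete Hausdorff complex locally convex space. Let $\Omega\subset X$ be a $1$-open set such that for every $a\in\Omega$ there exists $L\in\Gamma_2(X)$ with $a\in L$ and $\Omega\cap L$ bounded and open in $L$. Let $f\in\mathcal{H}_G(\Omega,Y)\cap\mathcal{C}_{(2)}(\Omega\cup\partial_2\Omega,Y)$. Then $f(\Omega)\sqsubset f(\partial_2\Omega)$; for every continuous seminorm $p$ on $Y$, $\sup_{x\in\Omega}p(f(x))=\sup_{x\in\partial_2\Omega}p(f(x))$; and for every domain of holomorphy $D\subset Y$, $f(\partial_2\Omega)\subset D$ implies $f(\Omega)\subset D$.
   Context: $\Gamma_d(X)$: complex affine subspaces of dimension $d$, Euclidean topology; $\Gamma_{1,d}=\bigcup_{k\le d}\Gamma_k$. $A$ is $d$-open if $A\cap L$ is open in $L$ for all $L\in\Gamma_{1,d}(X)$. $\partial_2A:=\bigcup_{L\in\Gamma_2(X)}\partial_L(A\cap L)$, boundaries taken in $L$. $\mathcal{C}_{(2)}(A,Y)$: maps $A\to Y$ whose restriction to $A\cap L$ is continuous for every $L\in\Gamma_{1,2}(X)$. $\mathcal{H}_G(\Omega,Y)$: maps with $\lambda\mapsto\varphi(f(a+\lambda v))$ holomorphic near $0$ for all $a\in\Omega,v\in X,\varphi\in Y^*$. $A\sqsubset B$ means: $A\subset\overline{\mathrm{co}}(B)$ if $\dim Y=\infty$; $A\subset\mathrm{co}(B)$ if $2\le\dim Y<\infty$; $A\subset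 B$ if $\dim Y=1$. Domain of holomorphy: open $D\subset Y$ for which there are no open $C,D_1\subset Y$ with $\emptyset\ne C\subset D\cap D_1$, $D_1$ connected, $D_1\not\subset D$, such that every $g|_C$ with $g$ continuous Gâteaux holomorphic on $D$ extends to a continuous Gâteaux holomorphic function on $D_1$. *)

theory Defs
  imports "HOL-Analysis.Analysis"
begin

text \<open>A complex vector space is modelled as a type with an abstract complex scalar
multiplication satisfying the vector_space locale. A Hausdorff complex locally
convex space is modelled by a family P of seminorms; its topology is the one
generated by the seminorms in P.\<close>

definition cseminorm :: "(complex \<Rightarrow> 'y::ab_group_add \<Rightarrow> 'y) \<Rightarrow> ('y \<Rightarrow> real) \<Rightarrow> bool" where
  "cseminorm sc p \<longleftrightarrow> (\<forall>x y. p (x + y) \<le> p x + p y) \<and> (\<forall>c x. p (sc c x) = cmod c * p x)"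

definition lc_open :: "('y::ab_group_add \<Rightarrow> real) set \<Rightarrow> 'y set \<Rightarrow> bool" where
  "lc_open P U \<longleftrightarrow> (\<forall>y\<in>U. \<exists>F e. finite F \<and> F \<subseteq> P \<and> e > 0 \<and>
      {z. \<forall>p\<in>F. p (z - y) < e} \<subseteq> U)"

lemma istopology_lc_open: "istopology (lc_open P)"
  unfolding istopology_def
proof (intro conjI allI impI)
  fix S T assume S: "lc_open P S" and T: "lc_open P T"
  show "lc_open P (S \<inter> T)"
    unfolding lc_open_def
  proof
    fix y assume y: "y \<in> S \<inter> T"
    have "\<exists>F e. finite F \<and> F \<subseteq> P \<and> e > 0 \<and> {z. \<forall>p\<in>F. p (z - y) < e} \<subseteq> S"
      using S IntD1[OF y] unfolding lc_open_def by (rule bspec)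
    then obtain F1 e1 where 1: "finite F1 \<and> F1 \<subseteq> P \<and> e1 > 0 \<and> {z. \<forall>p\<in>F1. p (z - y) < e1} \<subseteq> S"
      by (elim exE) (erule that)
    have "\<exists>F e. finite F \<and> F \<subseteq> P \<and> e > 0 \<and> {z. \<forall>p\<in>F. p (z - y) < e} \<subseteq> T"
      using T IntD2[OF y] unfolding lc_open_def by (rule bspec)
    then obtain F2 e2 where 2: "finite F2 \<and> F2 \<subseteq> P \<and> e2 > 0 \<and> {z. \<forall>p\<in>F2. p (z - y) < e2} \<subseteq> T"
      by (elim exE) (erule that)
    have s1: "{z. \<forall>p\<in>F1 \<union> F2. p (z - y) < min e1 e2} \<subseteq> {z. \<forall>p\<in>F1. p (z - y) < e1}"
      by auto
    have s2: "{z. \<forall>p\<in>F1 \<union> F2. p (z - y) < min e1 e2} \<subseteq> {z. \<forall>p\<in>F2. p (z - y) < e2}"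
      by auto
    have "finite (F1 \<union> F2) \<and> F1 \<union> F2 \<subseteq> P \<and> min e1 e2 > 0 \<and>
          {z. \<forall>p\<in>F1 \<union> F2. p (z - y) < min e1 e2} \<subseteq> S \<inter> T"
      using 1 2 s1 s2 by (simp only: finite_Un Un_least min_less_iff_conj subset_trans Int_greatest)
    then show "\<exists>F e. finite F \<and> F \<subseteq> P \<and> e > 0 \<and> {z. \<forall>p\<in>F. p (z - y) < e} \<subseteq> S \<inter> T"
      by (intro exI)
  qed
next
  fix K assume K: "\<forall>S\<in>K. lc_open P S"
  show "lc_open P (\<Union>K)" unfolding lc_open_def
  proof
    fix y assume "y \<in> \<Union>K"
    then obtain S where "S \<in> K" "y \<in> S" by (rule UnionE)
    then have "\<exists>F e. finite F \<and> F \<subseteq> P \<and> e > 0 \<and> {z. \<forall>p\<in>F. p (z - y) < e} \<subseteq> S"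
      using K unfolding lc_open_def by simp
    then show "\<exists>F e. finite F \<and> F \<subseteq> P \<and> e > 0 \<and> {z. \<forall>p\<in>F. p (z - y) < e} \<subseteq> \<Union>K"
      using \<open>S \<in> K\<close> by (meson Union_upper subset_trans)
  qed
qed

definition lc_topology :: "('y::ab_group_add \<Rightarrow> real) set \<Rightarrow> 'y topology" where
  "lc_topology P = topology (lc_open P)"

definition seq_complete_hausdorff_lcs ::
  "(complex \<Rightarrow> 'y::ab_group_add \<Rightarrow> 'y) \<Rightarrow> ('y \<Rightarrow> real) set \<Rightarrow> bool" where
  "seq_complete_hausdorff_lcs sc P \<longleftrightarrow>
     vector_space sc \<and> (\<forall>p\<in>P. cseminorm sc p) \<and> Hausdorff_space (lc_topology P) \<and>
     (\<forall>s :: nat \<Rightarrow> 'y. (\<forall>p\<in>P. \<forall>e>0. \<exists>N. \<forall>m\<ge>N. \<forall>n\<ge>N. p (s m - s n) < e)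
        \<longrightarrow> (\<exists>y. limitin (lc_topology P) s y sequentially))"

definition cont_seminorm :: "(complex \<Rightarrow> 'y::ab_group_add \<Rightarrow> 'y) \<Rightarrow> ('y \<Rightarrow> real) set \<Rightarrow> ('y \<Rightarrow> real) \<Rightarrow> bool" where
  "cont_seminorm sc P q \<longleftrightarrow> cseminorm sc q \<and> continuous_map (lc_topology P) euclidean q"

definition dual_space :: "(complex \<Rightarrow> 'y::ab_group_add \<Rightarrow> 'y) \<Rightarrow> ('y \<Rightarrow> real) set \<Rightarrow> ('y \<Rightarrow> complex) set" where
  "dual_space sc P = {\<phi>. Vector_Spaces.linear sc (*) \<phi> \<and> continuous_map (lc_topology P) euclidean \<phi>}"

text \<open>Complex lines (elements of Gamma_1) are parametrised by z \<mapsto> a + z v with v \<noteq> 0,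
complex planes (elements of Gamma_2) by (z1,z2) \<mapsto> a + z1 v1 + z2 v2 with v1, v2 linearly
independent; the Euclidean topology of L is transported along the parametrisation
(it does not depend on the chosen parametrisation).\<close>

definition cindep2 :: "(complex \<Rightarrow> 'x::ab_group_add \<Rightarrow> 'x) \<Rightarrow> 'x \<Rightarrow> 'x \<Rightarrow> bool" where
  "cindep2 sc v1 v2 \<longleftrightarrow> (\<forall>c1 c2. sc c1 v1 + sc c2 v2 = 0 \<longrightarrow> c1 = 0 \<and> c2 = 0)"

definition par1 :: "(complex \<Rightarrow> 'x::ab_group_add \<Rightarrow> 'x) \<Rightarrow> 'x \<Rightarrow> 'x \<Rightarrow> complex \<Rightarrow> 'x" where
  "par1 sc a v z = a + sc z v"

definition par2 :: "(complex \<Rightarrow> 'x::ab_group_add \<Rightarrow> 'x) \<Rightarrow> 'x \<Rightarrow> 'x \<Rightarrow> 'x \<Rightarrow> complex \<times> complex \<Rightarrow> 'x" where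
  "par2 sc a v1 v2 w = a + sc (fst w) v1 + sc (snd w) v2"

definition one_open :: "(complex \<Rightarrow> 'x::ab_group_add \<Rightarrow> 'x) \<Rightarrow> 'x set \<Rightarrow> bool" where
  "one_open sc A \<longleftrightarrow> (\<forall>a v. v \<noteq> 0 \<longrightarrow> open (par1 sc a v -` A))"

definition bd2 :: "(complex \<Rightarrow> 'x::ab_group_add \<Rightarrow> 'x) \<Rightarrow> 'x set \<Rightarrow> 'x set" where
  "bd2 sc A = (\<Union>(a, v1, v2) \<in> {(a, v1, v2). cindep2 sc v1 v2}.
                 par2 sc a v1 v2 ` frontier (par2 sc a v1 v2 -` A))"

definition C2_maps :: "(complex \<Rightarrow> 'x::ab_group_add \<Rightarrow> 'x) \<Rightarrow> ('y::ab_group_add \<Rightarrow> real) set \<Rightarrow> 'x set \<Rightarrow> ('x \<Rightarrow> 'y) set" where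
  "C2_maps sc P A = {f.
     (\<forall>a v. v \<noteq> 0 \<longrightarrow>
        continuous_map (subtopology euclidean (par1 sc a v -` A)) (lc_topology P) (f \<circ> par1 sc a v)) \<and>
     (\<forall>a v1 v2. cindep2 sc v1 v2 \<longrightarrow>
        continuous_map (subtopology euclidean (par2 sc a v1 v2 -` A)) (lc_topology P) (f \<circ> par2 sc a v1 v2))}"

definition HG_maps :: "(complex \<Rightarrow> 'x::ab_group_add \<Rightarrow> 'x) \<Rightarrow> (complex \<Rightarrow> 'y::ab_group_add \<Rightarrow> 'y) \<Rightarrow> ('y \<Rightarrow> real) set \<Rightarrow> 'x set \<Rightarrow> ('x \<Rightarrow> 'y) set" where
  "HG_maps scX scY P \<Omega> = {f. \<forall>a\<in>\<Omega>. \<forall>v. \<forall>\<phi>\<in>dual_space scY P. \<exists>r>0.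
       (\<forall>z\<in>ball 0 r. a + scX z v \<in> \<Omega>) \<and> (\<lambda>z. \<phi> (f (a + scX z v))) holomorphic_on ball 0 r}"

definition cconv_hull :: "(complex \<Rightarrow> 'y::ab_group_add \<Rightarrow> 'y) \<Rightarrow> 'y set \<Rightarrow> 'y set" where
  "cconv_hull sc B = {y. \<exists>(n::nat) t b. (\<forall>i<n. 0 \<le> t i \<and> b i \<in> B) \<and> (\<Sum>i<n. t i) = (1::real) \<and>
       y = (\<Sum>i<n. sc (complex_of_real (t i)) (b i))}"

definition fin_dim :: "(complex \<Rightarrow> 'y::ab_group_add \<Rightarrow> 'y) \<Rightarrow> bool" where
  "fin_dim sc \<longleftrightarrow> (\<exists>S. finite S \<and> module.span sc S = UNIV)"

definition sqsub :: "(complex \<Rightarrow> 'y::ab_group_add \<Rightarrow> 'y) \<Rightarrow> ('y \<Rightarrow> real) set \<Rightarrow> 'y set \<Rightarrow> 'y set \<Rightarrow> bool" where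
  "sqsub sc P A B \<longleftrightarrow>
     (if \<not> fin_dim sc then A \<subseteq> (lc_topology P) closure_of (cconv_hull sc B)
      else if vector_space.dim sc (UNIV :: 'y set) = 1 then A \<subseteq> B
      else A \<subseteq> cconv_hull sc B)"

definition cGhol :: "(complex \<Rightarrow> 'y::ab_group_add \<Rightarrow> 'y) \<Rightarrow> ('y \<Rightarrow> real) set \<Rightarrow> 'y set \<Rightarrow> ('y \<Rightarrow> complex) \<Rightarrow> bool" where
  "cGhol sc P D g \<longleftrightarrow> continuous_map (subtopology (lc_topology P) D) euclidean g \<and>
     (\<forall>a\<in>D. \<forall>v. \<exists>r>0. (\<forall>z\<in>ball 0 r. a + sc z v \<in> D) \<and> (\<lambda>z. g (a + sc z v)) holomorphic_on ball 0 r)"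

definition domain_of_holomorphy :: "(complex \<Rightarrow> 'y::ab_group_add \<Rightarrow> 'y) \<Rightarrow> ('y \<Rightarrow> real) set \<Rightarrow> 'y set \<Rightarrow> bool" where
  "domain_of_holomorphy sc P D \<longleftrightarrow> openin (lc_topology P) D \<and>
     \<not> (\<exists>C D1. openin (lc_topology P) C \<and> openin (lc_topology P) D1 \<and> C \<noteq> {} \<and>
           C \<subseteq> D \<inter> D1 \<and> connectedin (lc_topology P) D1 \<and> \<not> D1 \<subseteq> D \<and>
           (\<forall>g. cGhol sc P D g \<longrightarrow> (\<exists>h. cGhol sc P D1 h \<and> (\<forall>y\<in>C. h y = g y))))"

end

theory Submission
  imports Defs "HOL-Complex_Analysis.Complex_Analysis"
begin

text \<open>Everything happens in one plane, where \<Omega> becomes a bounded open set \<open>U \<subseteq> \<complex>\<^sup>2\<close>.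
The maximum principle for \<open>Re (\<phi> \<circ> f)\<close> on one-dimensional slices of U and Hahn--Banach put
\<open>f(U)\<close> into the closed convex hull of \<open>f(\<partial>U)\<close>, which gives the seminorm identity; if \<open>dim Y < \<infinity>\<close>,
the convex hull of the compact set \<open>f(\<partial>U)\<close> is already closed.

Suppose \<open>f(\<partial>U) \<subseteq> D\<close> for a domain of holomorphy D, but \<open>E = {w \<in> U. f w \<notin> D}\<close> is nonempty. It is
compact, so it has a point z farthest from some point outside E; pushing the complex tangent line
at z outwards yields discs that avoid E and tend to a disc meeting E only in z.
A Cauchy integral over the boundary of such a disc extends every holomorphic function on D to a
neighbourhood of the centre of uniform size, so \<open>f z \<in> D\<close> (Kontinuitaetssatz). In dimension 1 the same
discs and the function \<open>1 / (f - c)\<close> show that a value c of f on U is taken on \<open>\<partial>U\<close>.\<close>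

section \<open>Sublinear functionals and separation\<close>

text \<open>The hull statement needs only one complex line through each point; the domain statement
  and the case \<open>dim Y = 1\<close> need a second dimension. For the identity on the unit disc,
  0 is no value on the circle, and the plane without 0 is a domain of holomorphy. Inside a complex
  plane a disc meeting the exceptional set can be moved off it, which the extremal point makes
  possible.

  The obstacle in Y is that a test function g is only continuous and holomorphic along affine lines,
  so its composition with a curve has no chain rule for free. The curve first gets a genuine
  derivative, by sequential completeness, and is then compared with its tangent. The extension of g
  must also live on a connected set that does not shrink with the disc: a seminorm ball belonging to
  all boundary circles at once.

  Separation is done over the reals first: one infimum construction,
  \<open>sublinear_shrink\<close>, gives both the linearity of minimal functionals and the
  separating gap.\<close>

definition sublinear :: "(complex \<Rightarrow> 'y::ab_group_add \<Rightarrow> 'y) \<Rightarrow> ('y \<Rightarrow> real) \<Rightarrow> bool" where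
  "sublinear sc p \<longleftrightarrow> (\<forall>x y. p (x + y) \<le> p x + p y) \<and>
     (\<forall>r\<ge>0. \<forall>x. p (sc (complex_of_real r) x) = r * p x)"

lemma sublinear_triangle: "sublinear sc p \<Longrightarrow> p (x + y) \<le> p x + p y"
  and sublinear_scale: "sublinear sc p \<Longrightarrow> 0 \<le> r \<Longrightarrow> p (sc (complex_of_real r) x) = r * p x"
  by (auto simp: sublinear_def)

locale complex_space = vector_space sc
  for sc :: "complex \<Rightarrow> 'y::ab_group_add \<Rightarrow> 'y"
begin

lemma sublinear_zero:
  assumes "sublinear sc p" shows "p 0 = 0"
  using sublinear_scale[OF assms, of 0 0] by simp

lemma sublinear_ge_minus:
  assumes "sublinear sc p" shows "- p (- x) \<le> p x"
  using sublinear_triangle[OF assms, of x "-x"] sublinear_zero[OF assms] by simp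

text \<open>Lower p as far as the cone over \<open>K\<close> permits: \<open>q y\<close> is the
  infimum of \<open>p (y + t k) - t e\<close>. Convexity of \<open>K\<close> makes the cone closed
  under addition, hence q subadditive; \<open>e <= p\<close> on \<open>K\<close> keeps the infimum
  finite. Taking \<open>t = 1\<close> at \<open>y = - k\<close> gives the gap. With a singleton
  \<open>K\<close> this forces minimal functionals to be odd; with a translated convex set it
  separates.\<close>

lemma sublinear_shrink:
  assumes p: "sublinear sc p" and K0: "K \<noteq> {}"
    and conv: "\<And>k l s t. k \<in> K \<Longrightarrow> l \<in> K \<Longrightarrow> 0 \<le> s \<Longrightarrow> 0 \<le> t \<Longrightarrow> s + t = 1 \<Longrightarrow>
                 sc (of_real s) k + sc (of_real t) l \<in> K"
    and e: "\<And>k. k \<in> K \<Longrightarrow> e \<le> p k"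
  obtains q where "sublinear sc q" "q \<le> p" "\<And>k. k \<in> K \<Longrightarrow> q (- k) \<le> - e"
proof -
  define V where "V = (\<lambda>y. {p (y + sc (of_real t) k) - t * e |t k. 0 \<le> t \<and> k \<in> K})"
  define q where "q = (\<lambda>y. Inf (V y))"
  have Vne: "V y \<noteq> {}" for y
  proof -
    obtain k where "k \<in> K" using K0 by blast
    then have "p (y + sc (of_real 0) k) - 0 * e \<in> V y"
      unfolding V_def mem_Collect_eq by (intro exI[of _ 0] exI[of _ k]) simp
    then show ?thesis by blast
  qed
  have Vlow: "- p (- y) \<le> w" if w: "w \<in> V y" for y w
  proof -
    obtain t k where tk: "0 \<le> t" "k \<in> K" "w = p (y + sc (of_real t) k) - t * e"
      using w by (auto simp: V_def)
    have "t * e \<le> t * p k" using e tk by (simp add: mult_left_mono)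
    also have "\<dots> = p (sc (of_real t) k)" using sublinear_scale[OF p tk(1)] by simp
    also have "\<dots> \<le> p (y + sc (of_real t) k) + p (- y)"
      using sublinear_triangle[OF p, of "y + sc (of_real t) k" "-y"] by (simp add: algebra_simps)
    finally show ?thesis using tk by simp
  qed
  have bdd: "bdd_below (V y)" for y using Vlow by (rule bdd_belowI)
  have q_le: "q y \<le> p (y + sc (of_real t) k) - t * e" if "0 \<le> t" "k \<in> K" for y t k
    unfolding q_def by (rule cInf_lower[OF _ bdd]) (use that in \<open>auto simp: V_def\<close>)
  have V_add: "\<exists>w\<in>V (x + y). w \<le> v1 + v2" if v1: "v1 \<in> V x" and v2: "v2 \<in> V y" for x y v1 v2
  proof -
    obtain s k where sk: "0 \<le> s" "k \<in> K" "v1 = p (x + sc (of_real s) k) - s * e"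
      using v1 by (auto simp: V_def)
    obtain t l where tl: "0 \<le> t" "l \<in> K" "v2 = p (y + sc (of_real t) l) - t * e"
      using v2 by (auto simp: V_def)
    \<comment> \<open>Normalise the two weights by \<open>s + t\<close>; if both vanish, any member
      of \<open>K\<close> will do.\<close>
    obtain m where m: "m \<in> K" "sc (of_real s) k + sc (of_real t) l = sc (of_real (s + t)) m"
    proof (cases "s + t = 0")
      case True
      then have "s = 0" "t = 0" using sk tl by auto
      then show ?thesis using that[of k] sk by simp
    next
      case False
      define m where "m = sc (of_real (s/(s+t))) k + sc (of_real (t/(s+t))) l"
      have "m \<in> K" unfolding m_def
        by (rule conv) (use sk tl False in \<open>auto simp: add_divide_distrib[symmetric]\<close>)
      moreover have "sc (of_real (s + t)) m = sc (of_real s) k + sc (of_real t) l"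
        unfolding m_def scale_right_distrib scale_scale of_real_mult[symmetric] using False by simp
      ultimately show ?thesis using that by simp
    qed
    have "p ((x + y) + sc (of_real (s + t)) m) \<le> p (x + sc (of_real s) k) + p (y + sc (of_real t) l)"
      using sublinear_triangle[OF p, of "x + sc (of_real s) k" "y + sc (of_real t) l"]
      unfolding m(2)[symmetric] by (simp add: ac_simps)
    moreover have "p ((x + y) + sc (of_real (s + t)) m) - (s + t) * e \<in> V (x + y)"
      unfolding V_def mem_Collect_eq by (intro exI[of _ "s + t"] exI[of _ m]) (use sk tl m in auto)
    ultimately show ?thesis using sk tl by (intro bexI) (auto simp: algebra_simps)
  qed
  have q_add: "q (x + y) \<le> q x + q y" for x y
  proof -
    have "q (x + y) - v2 \<le> q x" if v2: "v2 \<in> V y" for v2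
      unfolding q_def[THEN fun_cong, of x]
    proof (rule cInf_greatest[OF Vne])
      fix v1 assume "v1 \<in> V x"
      then obtain w where "w \<in> V (x + y)" "w \<le> v1 + v2" using V_add v2 by blast
      then have "q (x + y) \<le> v1 + v2"
        unfolding q_def using cInf_lower[OF _ bdd] by (meson order_trans)
      then show "q (x + y) - v2 \<le> v1" by simp
    qed
    then have "q (x + y) - q x \<le> v2" if "v2 \<in> V y" for v2 using that by (simp add: algebra_simps)
    then have "q (x + y) - q x \<le> q y"
      unfolding q_def[THEN fun_cong, of y] by (rule cInf_greatest[OF Vne])
    then show ?thesis by simp
  qed
  have q_le_p: "q y \<le> p y" for y
    using q_le[of 0 _ y] K0 by auto
  have q_scale_le: "r * q x \<le> q (sc (of_real r) x)" if r: "0 < r" for r x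
    unfolding q_def[THEN fun_cong, of "sc (of_real r) x"]
  proof (rule cInf_greatest[OF Vne])
    fix v assume "v \<in> V (sc (of_real r) x)"
    then obtain t k where tk: "0 \<le> t" "k \<in> K" "v = p (sc (of_real r) x + sc (of_real t) k) - t * e"
      by (auto simp: V_def)
    have "sc (of_real r) x + sc (of_real t) k = sc (of_real r) (x + sc (of_real (t/r)) k)"
      unfolding scale_right_distrib scale_scale of_real_mult[symmetric] using r by simp
    then have "p (sc (of_real r) x + sc (of_real t) k) = r * p (x + sc (of_real (t/r)) k)"
      by (simp only: sublinear_scale[OF p less_imp_le[OF r]])
    then have "v = r * (p (x + sc (of_real (t/r)) k) - (t/r) * e)"
      using tk(3) r by (simp add: right_diff_distrib)
    then show "r * q x \<le> v" using q_le[of "t/r" k x] tk r by simp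
  qed
  have q0: "q 0 = 0"
    using q_add[of 0 0] q_le_p[of 0] sublinear_zero[OF p] by simp
  have q_scale: "q (sc (of_real r) x) = r * q x" if "0 \<le> r" for r x
  proof (cases "r = 0")
    case True then show ?thesis using q0 by simp
  next
    case False
    then have r: "0 < r" using that by simp
    \<comment> \<open>The missing inequality is \<open>q_scale_le\<close> for \<open>1/r\<close>,
      applied to the scaled vector.\<close>
    have "(1/r) * q (sc (of_real r) x) \<le> q (sc (of_real (1/r)) (sc (of_real r) x))"
      by (rule q_scale_le) (use r in simp)
    also have "sc (of_real (1/r)) (sc (of_real r) x) = x"
      unfolding scale_scale of_real_mult[symmetric] using r by simp
    finally have "q (sc (of_real r) x) \<le> r * q x" using r by (simp add: field_simps)
    then show ?thesis using q_scale_le[OF r, of x] by simp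
  qed
  show ?thesis
  proof (rule that[of q])
    show "sublinear sc q" unfolding sublinear_def using q_add q_scale by auto
    show "q \<le> p" using q_le_p by (simp add: le_fun_def)
    show "q (- k) \<le> - e" if "k \<in> K" for k
      using q_le[of 1 k "-k"] that sublinear_zero[OF p] by simp
  qed
qed

text \<open>Hahn--Banach: a minimal element among the sublinear functionals below p is linear,
since shrinking it along a single direction cannot change it.\<close>

lemma sublinear_dominates_linear:
  assumes p: "sublinear sc p"
  obtains u where "u \<le> p" "\<And>x y. u (x + y) = u x + u y"
    "\<And>r x. u (sc (of_real r) x) = r * u x"
proof -
  define A where "A = {q. sublinear sc q \<and> q \<le> p}"
  have "\<exists>m\<in>A. \<forall>a\<in>A. m \<ge> a \<longrightarrow> a = m"
  proof (rule predicate_Zorn)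
    show "partial_order_on A (relation_of (\<ge>) A)"
      by (auto simp: partial_order_on_def preorder_on_def refl_on_def trans_def antisym_def relation_of_def)
    fix C assume C: "C \<in> Chains (relation_of (\<ge>) A)"
    then have CA: "C \<subseteq> A" by (auto simp: Chains_def relation_of_def)
    have tot: "a \<le> b \<or> b \<le> a" if "a \<in> C" "b \<in> C" for a b
      using C that by (auto simp: Chains_def relation_of_def)
    show "\<exists>u\<in>A. \<forall>a\<in>C. a \<ge> u"
    proof (cases "C = {}")
      case True then show ?thesis using p unfolding A_def by blast
    next
      case False
      define u where "u = (\<lambda>x. INF q\<in>C. q x)"
      have low: "- p (- x) \<le> q x" if "q \<in> C" for q x
      proof -
        have "sublinear sc q" "q \<le> p" using that CA unfolding A_def by auto
        then have "- q (- x) \<le> q x" "q (- x) \<le> p (- x)"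
          using sublinear_ge_minus by (auto simp: le_fun_def)
        then show ?thesis by simp
      qed
      have bdd: "bdd_below ((\<lambda>q. q x) ` C)" for x
        by (rule bdd_belowI2[where m = "- p (- x)"]) (rule low)
      have u_le: "u x \<le> q x" if "q \<in> C" for q x
        unfolding u_def by (rule cINF_lower[OF bdd that])
      have u_ge: "c \<le> u x" if "\<And>q. q \<in> C \<Longrightarrow> c \<le> q x" for c x
        unfolding u_def by (rule cINF_greatest[OF False that])
      have sub: "sublinear sc q" if "q \<in> C" for q using that CA by (auto simp: A_def)
      have add: "u (x + y) \<le> u x + u y" for x y
      proof -
        \<comment> \<open>Two members of a chain are comparable, so the smaller one bounds both
          terms at once; two unrelated functionals would not do.\<close>
        have *: "u (x + y) \<le> q x + r y" if qr: "q \<in> C" "r \<in> C" for q r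
        proof (cases "q \<le> r")
          case True
          have "u (x + y) \<le> q x + q y"
            using u_le[OF qr(1), of "x + y"] sublinear_triangle[OF sub[OF qr(1)], of x y] by simp
          then show ?thesis using True[THEN le_funD, of y] by simp
        next
          case False
          then have "r x \<le> q x" using tot[OF qr] by (auto simp: le_fun_def)
          then show ?thesis
            using u_le[OF qr(2), of "x + y"] sublinear_triangle[OF sub[OF qr(2)], of x y] by simp
        qed
        have "u (x + y) - r y \<le> u x" if "r \<in> C" for r
          by (rule u_ge) (use * that in \<open>auto simp: algebra_simps\<close>)
        then have "u (x + y) - u x \<le> u y"
          by (intro u_ge) (auto simp: algebra_simps)
        then show ?thesis by simp
      qed
      have scale: "u (sc (of_real r) x) = r * u x" if r: "0 \<le> r" for r x
      proof -
        have eq: "q (sc (of_real r) x) = r * q x" if "q \<in> C" for q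
          using sublinear_scale[OF sub[OF that] r] .
        show ?thesis
        proof (cases "r = 0")
          case True
          have "(INF q\<in>C. q 0) = (INF q\<in>C. 0 :: real)"
            by (rule INF_cong) (use True eq in simp_all)
          then show ?thesis using True False unfolding u_def by simp
        next
          case F: False
          then have rp: "0 < r" using r by simp
          have "r * u x \<le> u (sc (of_real r) x)"
            by (rule u_ge) (simp only: eq mult_left_mono[OF u_le r])
          moreover have "u (sc (of_real r) x) / r \<le> u x"
          proof (rule u_ge)
            fix q assume q: "q \<in> C"
            have "u (sc (of_real r) x) \<le> r * q x"
              using u_le[OF q, of "sc (of_real r) x"] eq[OF q] by simp
            then show "u (sc (of_real r) x) / r \<le> q x" using rp by (simp add: field_simps)
          qed
          ultimately show ?thesis using rp by (simp add: field_simps)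
        qed
      qed
      obtain q where "q \<in> C" using False by blast
      then have "q \<le> p" using CA by (auto simp: A_def)
      then have "u \<le> p"
        using u_le[OF \<open>q \<in> C\<close>] by (meson le_funD le_funI order_trans)
      then have "u \<in> A" using add scale by (auto simp: A_def sublinear_def)
      then show ?thesis using u_le by (auto simp: le_fun_def)
    qed
  qed
  then obtain u where uA: "u \<in> A" and minA: "\<And>q. q \<in> A \<Longrightarrow> q \<le> u \<Longrightarrow> q = u"
    by blast
  have u: "sublinear sc u" "u \<le> p" using uA by (auto simp: A_def)
  have min: "q = u" if "sublinear sc q" "q \<le> u" for q
    using minA[of q] that u(2) by (auto simp: A_def intro: order_trans)
  have neg: "u (- z) \<le> - u z" for z
  proof -
    obtain q where q: "sublinear sc q" "q \<le> u" "\<And>k. k \<in> {z} \<Longrightarrow> q (- k) \<le> - u z"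
      by (rule sublinear_shrink[OF u(1), of "{z}" "u z"])
         (auto simp: scale_left_distrib[symmetric] of_real_add[symmetric] simp del: of_real_add)
    then show ?thesis using min[OF q(1,2)] by auto
  qed
  have neg_eq: "u (- z) = - u z" for z
    using neg[of z] sublinear_ge_minus[OF u(1), of z] by simp
  show ?thesis
  proof (rule that[of u])
    show "u \<le> p" by (rule u(2))
    \<comment> \<open>A subadditive odd functional is additive: subadditivity at \<open>-x\<close>,
      \<open>-y\<close> gives the reverse inequality.\<close>
    show "u (x + y) = u x + u y" for x y
      using sublinear_triangle[OF u(1), of x y] sublinear_triangle[OF u(1), of "-x" "-y"]
        neg_eq[of x] neg_eq[of y] neg_eq[of "x + y"] by simp
    show "u (sc (of_real r) x) = r * u x" for r x
      using sublinear_scale[OF u(1), of r x] sublinear_scale[OF u(1), of "-r" x]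
        neg_eq[of "sc (of_real r) x"] by (cases "0 \<le> r") auto
  qed
qed

section \<open>Complex seminorms, and the passage from real to complex functionals\<close>

lemma cseminorm_triangle: "cseminorm sc p \<Longrightarrow> p (x + y) \<le> p x + p y"
  and cseminorm_scale: "cseminorm sc p \<Longrightarrow> p (sc c x) = cmod c * p x"
  by (auto simp: cseminorm_def)

lemma cseminorm_sublinear: "cseminorm sc p \<Longrightarrow> sublinear sc p"
  by (auto simp: cseminorm_def sublinear_def)

lemma cseminorm_zero: "cseminorm sc p \<Longrightarrow> p 0 = 0"
  using cseminorm_scale[of p 0 0] by simp

lemma cseminorm_minus: "cseminorm sc p \<Longrightarrow> p (- x) = p x"
  using cseminorm_scale[of p "-1" x] by simp

lemma cseminorm_commute: "cseminorm sc p \<Longrightarrow> p (x - y) = p (y - x)"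
  using cseminorm_minus[of p "x - y"] by simp

lemma cseminorm_nonneg: "cseminorm sc p \<Longrightarrow> 0 \<le> p x"
  using cseminorm_triangle[of p x "-x"] cseminorm_minus[of p x] cseminorm_zero[of p] by simp

lemma cseminorm_diff_triangle: "cseminorm sc p \<Longrightarrow> p (x - z) \<le> p (x - y) + p (y - z)"
  using cseminorm_triangle[of p "x - y" "y - z"] by simp

lemma cseminorm_diff_ge: "cseminorm sc p \<Longrightarrow> \<bar>p x - p y\<bar> \<le> p (x - y)"
  using cseminorm_triangle[of p "x - y" y] cseminorm_triangle[of p "y - x" x]
    cseminorm_commute[of p x y] by simp

text \<open>Lowering p along \<open>K - x\<close> and taking a real-linear u below the result makes
  \<open>u (x - k) <= - e\<close>; u is then the real part of the wanted functional. A convex set at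
  p-distance at least e from x is thus separated by a gap e, with the functional still bounded by
  p.\<close>

lemma complex_separation:
  assumes p: "cseminorm sc p" and K0: "K \<noteq> {}"
    and conv: "\<And>k l s t. k \<in> K \<Longrightarrow> l \<in> K \<Longrightarrow> 0 \<le> s \<Longrightarrow> 0 \<le> t \<Longrightarrow> s + t = 1 \<Longrightarrow>
                 sc (of_real s) k + sc (of_real t) l \<in> K"
    and e: "\<And>k. k \<in> K \<Longrightarrow> e \<le> p (k - x)"
  obtains \<phi> where "Vector_Spaces.linear sc (*) \<phi>" "\<And>y. cmod (\<phi> y) \<le> p y"
    "\<And>k. k \<in> K \<Longrightarrow> Re (\<phi> x) + e \<le> Re (\<phi> k)"
proof -
  define L where "L = (\<lambda>k. k - x) ` K"
  obtain q where q: "sublinear sc q" "q \<le> p" "\<And>k. k \<in> L \<Longrightarrow> q (- k) \<le> - e"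
  proof (rule sublinear_shrink[OF cseminorm_sublinear[OF p], of L e])
    show "L \<noteq> {}" using K0 by (simp add: L_def)
    show "e \<le> p k" if "k \<in> L" for k using that e by (auto simp: L_def)
    fix k l :: 'y and s t :: real assume kl: "k \<in> L" "l \<in> L" and st: "0 \<le> s" "0 \<le> t" "s + t = 1"
    obtain k' l' where *: "k' \<in> K" "l' \<in> K" "k = k' - x" "l = l' - x" using kl by (auto simp: L_def)
    have "sc (of_real s) x + sc (of_real t) x = x"
      unfolding scale_left_distrib[symmetric] of_real_add[symmetric] using st by simp
    then have "sc (of_real s) k + sc (of_real t) l = (sc (of_real s) k' + sc (of_real t) l') - x"
      unfolding * scale_right_diff_distrib by (simp add: algebra_simps)
    then show "sc (of_real s) k + sc (of_real t) l \<in> L"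
      unfolding L_def using conv[OF *(1,2) st] by blast
  qed blast
  obtain u where u: "u \<le> q" "\<And>x y. u (x + y) = u x + u y" "\<And>r x. u (sc (of_real r) x) = r * u x"
    using sublinear_dominates_linear[OF q(1)] by blast
  have u0: "u 0 = 0" using u(2)[of 0 0] by simp
  have u_neg: "u (- y) = - u y" for y using u(2)[of y "-y"] u0 by simp
  have u_diff: "u (y - z) = u y - u z" for y z using u(2)[of y "-z"] u_neg by simp
  \<comment> \<open>u is only real linear; \<open>u y - i u (i y)\<close> is the complex-linear
    functional with real part u.\<close>
  define \<phi> where "\<phi> = (\<lambda>y. Complex (u y) (- u (sc \<i> y)))"
  have add: "\<phi> (y + z) = \<phi> y + \<phi> z" for y z
    by (simp add: \<phi>_def u(2) scale_right_distrib complex_eq_iff)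
  have scale: "\<phi> (sc c y) = c * \<phi> y" for c y
  proof -
    have 1: "sc c y = sc (of_real (Re c)) y + sc (of_real (Im c)) (sc \<i> y)"
      unfolding scale_scale scale_left_distrib[symmetric]
      by (rule arg_cong[where f = "\<lambda>c. sc c y"]) (simp add: complex_eq_iff)
    have 2: "sc \<i> (sc c y) = sc (of_real (Re c)) (sc \<i> y) + sc (of_real (- Im c)) y"
      unfolding scale_scale scale_left_distrib[symmetric]
      by (rule arg_cong[where f = "\<lambda>c. sc c y"]) (simp add: complex_eq_iff)
    show ?thesis unfolding \<phi>_def 2 unfolding 1 u(2) u(3) by (simp add: complex_eq_iff)
  qed
  have vs: "vector_space ((*) :: complex \<Rightarrow> complex \<Rightarrow> complex)"
    by unfold_locales (auto simp: algebra_simps)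
  have lin: "Vector_Spaces.linear sc (*) \<phi>"
    unfolding Vector_Spaces.linear_iff by (intro conjI allI vs vector_space_axioms add scale)
  have up: "u y \<le> p y" for y using u(1) q(2) by (meson le_funD order_trans)
  have bound: "cmod (\<phi> y) \<le> p y" for y
  proof (cases "\<phi> y = 0")
    case True then show ?thesis using cseminorm_nonneg[OF p] by simp
  next
    case False
    \<comment> \<open>A unimodular rotation makes the value real and non-negative, where the
      one-sided bound \<open>u <= p\<close> suffices.\<close>
    define c where "c = of_real (cmod (\<phi> y)) / \<phi> y"
    have c: "cmod c = 1" using False by (simp add: c_def norm_divide)
    have "cmod (\<phi> y) = Re (\<phi> (sc c y))" using False by (simp add: scale c_def)
    also have "\<dots> = u (sc c y)" by (simp add: \<phi>_def)
    also have "\<dots> \<le> p (sc c y)" by (rule up)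
    finally show ?thesis using cseminorm_scale[OF p] c by simp
  qed
  have "Re (\<phi> x) + e \<le> Re (\<phi> k)" if "k \<in> K" for k
  proof -
    have "u (- (k - x)) \<le> - e" using u(1) q(3)[of "k - x"] that
      unfolding L_def by (meson le_funD order_trans imageI)
    then show ?thesis by (simp add: \<phi>_def u_diff)
  qed
  then show ?thesis using that lin bound by blast
qed

end

section \<open>Locally convex topologies\<close>

lemma openin_lc_topology: "openin (lc_topology P) U \<longleftrightarrow> lc_open P U"
  by (simp add: lc_topology_def istopology_lc_open topology_inverse')

lemma topspace_lc_topology [simp]: "topspace (lc_topology P) = UNIV"
proof -
  have "openin (lc_topology P) UNIV"
    unfolding openin_lc_topology lc_open_def by (auto intro!: exI[of _ "{}"] exI[of _ 1])
  then show ?thesis using openin_subset by blast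
qed

locale lc_space = complex_space sc
  for sc :: "complex \<Rightarrow> 'y::ab_group_add \<Rightarrow> 'y" +
  fixes P :: "('y \<Rightarrow> real) set"
  assumes seminorms: "p \<in> P \<Longrightarrow> cseminorm sc p"
begin

abbreviation "CS \<equiv> cont_seminorm sc P"
abbreviation "T \<equiv> lc_topology P"

lemma CS_cseminorm: "CS q \<Longrightarrow> cseminorm sc q"
  by (simp add: cont_seminorm_def)

lemma CS_nbhd:
  assumes "CS q"
  obtains F e where "finite F" "F \<subseteq> P" "e > 0" "\<forall>z. (\<forall>p\<in>F. p z < e) \<longrightarrow> q z < 1"
proof -
  have "openin T {y \<in> topspace T. q y \<in> {..<1}}"
    using assms unfolding cont_seminorm_def
    by (intro openin_continuous_map_preimage[where Y = euclidean]) auto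
  then have op: "lc_open P {y. q y < 1}" by (simp add: openin_lc_topology)
  have "0 \<in> {y. q y < 1}" using cseminorm_zero[OF CS_cseminorm[OF assms]] by simp
  from bspec[OF op[unfolded lc_open_def] this]
  obtain F e where "finite F" "F \<subseteq> P" "e > 0" "{z. \<forall>p\<in>F. p (z - 0) < e} \<subseteq> {y. q y < 1}"
    by (elim exE conjE)
  then show ?thesis using that[of F e] by auto
qed

lemma CS_I:
  assumes q: "cseminorm sc q" and F: "finite F" "F \<subseteq> P" and a: "0 \<le> a"
    and le: "\<And>y. q y \<le> a * (\<Sum>p\<in>F. p y)"
  shows "CS q"
  unfolding cont_seminorm_def continuous_map_def
proof (intro conjI allI impI q)
  fix V :: "real set" assume "openin euclidean V"
  then have V: "open V" by simp
  have "lc_open P {y. q y \<in> V}"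
    unfolding lc_open_def
  proof
    fix y assume "y \<in> {y. q y \<in> V}"
    then have "q y \<in> V" by simp
    then obtain e where e: "e > 0" "ball (q y) e \<subseteq> V" using openE[OF V] by blast
    \<comment> \<open>The summand 1 keeps the denominator positive when \<open>a\<close> is 0 or
      \<open>F\<close> is empty.\<close>
    define d where "d = e / (a * card F + 1)"
    have pos: "a * card F + 1 > 0" using a by (simp add: add_nonneg_pos)
    then have d: "d > 0" using e by (simp add: d_def)
    have "q z \<in> V" if z: "\<forall>p\<in>F. p (z - y) < d" for z
    proof -
      have "(\<Sum>p\<in>F. p (z - y)) \<le> card F * d"
        using sum_bounded_above[of F "\<lambda>p. p (z - y)" d] z by (auto simp: less_imp_le)
      then have "q (z - y) \<le> a * (card F * d)"
        using le[of "z - y"] a by (meson mult_left_mono order_trans)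
      also have "\<dots> < e"
        using e pos by (simp add: d_def field_simps)
      finally have "\<bar>q z - q y\<bar> < e" using cseminorm_diff_ge[OF q, of z y] by simp
      then show ?thesis using e by (auto simp: dist_real_def)
    qed
    then show "\<exists>F e. finite F \<and> F \<subseteq> P \<and> 0 < e \<and> {z. \<forall>p\<in>F. p (z - y) < e} \<subseteq> {y. q y \<in> V}"
      using F d by blast
  qed
  then show "openin T {x \<in> topspace T. q x \<in> V}" by (simp add: openin_lc_topology)
qed (simp add: q)

lemma cseminorm_mult: "cseminorm sc q \<Longrightarrow> 0 \<le> a \<Longrightarrow> cseminorm sc (\<lambda>y. a * q y)"
  by (auto simp: cseminorm_def distrib_left[symmetric] mult_left_mono)

lemma cseminorm_sum:
  "(\<And>p. p \<in> F \<Longrightarrow> cseminorm sc (h p)) \<Longrightarrow> cseminorm sc (\<lambda>y. \<Sum>p\<in>F. h p y)"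
  by (auto simp: cseminorm_def sum_distrib_left sum.distrib[symmetric] intro!: sum_mono)

lemma CS_mult: "CS q \<Longrightarrow> 0 \<le> a \<Longrightarrow> CS (\<lambda>y. a * q y)"
  unfolding cont_seminorm_def by (auto intro: cseminorm_mult continuous_map_real_mult_left)

lemma CS_sum: "finite I \<Longrightarrow> (\<And>i. i \<in> I \<Longrightarrow> CS (h i)) \<Longrightarrow> CS (\<lambda>y. \<Sum>i\<in>I. h i y)"
  unfolding cont_seminorm_def by (auto intro: cseminorm_sum continuous_map_sum)

lemma CS_add: "CS q \<Longrightarrow> CS r \<Longrightarrow> CS (\<lambda>y. q y + r y)"
  using CS_sum[of "UNIV :: bool set" "\<lambda>b. if b then q else r"] by (simp add: UNIV_bool add.commute)

text \<open>Continuous seminorms, unlike the members of \<open>P\<close> in general, are closed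
  under finite sums and positive multiples, so every neighbourhood contains a unit ball of a single
  one.\<close>

lemma openin_iff_CS:
  "openin T U \<longleftrightarrow> (\<forall>y\<in>U. \<exists>q. CS q \<and> (\<forall>z. q (z - y) < 1 \<longrightarrow> z \<in> U))"
  (is "?L \<longleftrightarrow> ?R")
proof
  assume ?L
  show ?R
  proof
    fix y assume "y \<in> U"
    from bspec[OF \<open>?L\<close>[unfolded openin_lc_topology lc_open_def] this]
    obtain F e where Fe: "finite F" "F \<subseteq> P" "e > 0" "{z. \<forall>p\<in>F. p (z - y) < e} \<subseteq> U"
      by (elim exE conjE)
    define q where "q = (\<lambda>y. (1/e) * (\<Sum>p\<in>F. p y))"
    have "cseminorm sc q"
      unfolding q_def using Fe seminorms by (intro cseminorm_mult cseminorm_sum) auto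
    then have "CS q" using Fe by (intro CS_I[of q F "1/e"]) (auto simp: q_def)
    moreover have "z \<in> U" if "q (z - y) < 1" for z
    proof -
      have "p (z - y) < e" if p: "p \<in> F" for p
      proof -
        have "p (z - y) \<le> (\<Sum>p\<in>F. p (z - y))"
          using p Fe seminorms by (intro member_le_sum) (auto intro: cseminorm_nonneg)
        then show ?thesis using \<open>q (z - y) < 1\<close> Fe by (simp add: q_def field_simps)
      qed
      then show ?thesis using Fe by blast
    qed
    ultimately show "\<exists>q. CS q \<and> (\<forall>z. q (z - y) < 1 \<longrightarrow> z \<in> U)" by blast
  qed
next
  assume R: ?R
  show ?L unfolding openin_lc_topology lc_open_def
  proof
    fix y assume "y \<in> U"
    then obtain q where q: "CS q" "\<And>z. q (z - y) < 1 \<Longrightarrow> z \<in> U" using R by blast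
    obtain F e where "finite F" "F \<subseteq> P" "e > 0" "\<forall>z. (\<forall>p\<in>F. p z < e) \<longrightarrow> q z < 1"
      using CS_nbhd[OF q(1)] by blast
    then show "\<exists>F e. finite F \<and> F \<subseteq> P \<and> 0 < e \<and> {z. \<forall>p\<in>F. p (z - y) < e} \<subseteq> U"
      using q(2) by (intro exI[of _ F] exI[of _ e]) auto
  qed
qed

lemma openin_CS_ball:
  assumes "CS q" shows "openin T {z. q (z - y) < r}"
  unfolding openin_iff_CS
proof
  fix x assume x: "x \<in> {z. q (z - y) < r}"
  define e where "e = r - q (x - y)"
  have e: "e > 0" using x by (simp add: e_def)
  have "q (z - y) < r" if "(1/e) * q (z - x) < 1" for z
    using that e cseminorm_diff_triangle[OF CS_cseminorm[OF assms], of z y x]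
    by (simp add: field_simps e_def)
  then show "\<exists>p. CS p \<and> (\<forall>z. p (z - x) < 1 \<longrightarrow> z \<in> {z. q (z - y) < r})"
    using CS_mult[OF assms, of "1/e"] e by (intro exI[of _ "\<lambda>y. (1/e) * q y"]) auto
qed

lemma continuous_map_lcD:
  fixes h :: "'y \<Rightarrow> 'b::metric_space"
  assumes "continuous_map (subtopology T D) euclidean h" "openin T D" "y \<in> D" "e > 0"
  obtains q where "CS q" "\<And>z. q (z - y) < 1 \<Longrightarrow> z \<in> D \<and> dist (h z) (h y) < e"
proof -
  have "openin (subtopology T D) {z \<in> topspace (subtopology T D). h z \<in> ball (h y) e}"
    using assms by (intro openin_continuous_map_preimage) auto
  then have "openin T {z \<in> D. h z \<in> ball (h y) e}"
    using assms by (simp add: openin_open_subtopology)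
  moreover have "y \<in> {z \<in> D. h z \<in> ball (h y) e}" using assms by simp
  ultimately obtain q where "CS q" "\<forall>z. q (z - y) < 1 \<longrightarrow> z \<in> {z \<in> D. h z \<in> ball (h y) e}"
    unfolding openin_iff_CS by blast
  then show ?thesis using that[of q] by (auto simp: dist_commute)
qed

lemma continuous_map_lcI:
  fixes h :: "'y \<Rightarrow> 'b::metric_space"
  assumes "openin T D"
    and "\<And>y e. y \<in> D \<Longrightarrow> e > 0 \<Longrightarrow> \<exists>q. CS q \<and> (\<forall>z\<in>D. q (z - y) < 1 \<longrightarrow> dist (h z) (h y) < e)"
  shows "continuous_map (subtopology T D) euclidean h"
  unfolding continuous_map_def
proof (intro conjI allI impI)
  fix V :: "'b set" assume "openin euclidean V"
  then have V: "open V" by simp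
  have "openin T {z \<in> D. h z \<in> V}"
    unfolding openin_iff_CS
  proof
    fix y assume y: "y \<in> {z \<in> D. h z \<in> V}"
    then have "h y \<in> V" by simp
    then obtain e where e: "e > 0" "ball (h y) e \<subseteq> V" using openE[OF V] by blast
    obtain q where q: "CS q" "\<forall>z\<in>D. q (z - y) < 1 \<longrightarrow> dist (h z) (h y) < e"
      using assms(2) y e by blast
    obtain r where r: "CS r" "\<forall>z. r (z - y) < 1 \<longrightarrow> z \<in> D"
      using assms(1) y unfolding openin_iff_CS by blast
    have "z \<in> {z \<in> D. h z \<in> V}" if z: "q (z - y) + r (z - y) < 1" for z
    proof -
      have "q (z - y) < 1" "r (z - y) < 1"
        using z cseminorm_nonneg[OF CS_cseminorm[OF q(1)], of "z - y"]
          cseminorm_nonneg[OF CS_cseminorm[OF r(1)], of "z - y"] by auto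
      moreover from this have zD: "z \<in> D" using r(2) by blast
      ultimately have "dist (h z) (h y) < e" using q(2) by blast
      then have "h z \<in> ball (h y) e" by (simp add: dist_commute)
      then show ?thesis using e zD by blast
    qed
    then show "\<exists>q. CS q \<and> (\<forall>z. q (z - y) < 1 \<longrightarrow> z \<in> {z \<in> D. h z \<in> V})"
      using CS_add[OF q(1) r(1)] by blast
  qed
  then show "openin (subtopology T D) {x \<in> topspace (subtopology T D). h x \<in> V}"
    using assms(1) by (simp add: openin_open_subtopology)
qed simp

section \<open>Continuous maps from metric spaces into Y\<close>

abbreviation lcc :: "'a::metric_space set \<Rightarrow> ('a \<Rightarrow> 'y) \<Rightarrow> bool" where
  "lcc S g \<equiv> continuous_map (top_of_set S) T g"

lemma lcc_iff:
  fixes g :: "'a::metric_space \<Rightarrow> 'y"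
  shows "lcc S g \<longleftrightarrow> (\<forall>x\<in>S. \<forall>q. CS q \<longrightarrow> (\<forall>e>0. \<exists>d>0. \<forall>x'\<in>S. dist x' x < d \<longrightarrow> q (g x' - g x) < e))"
  (is "_ \<longleftrightarrow> ?R")
proof
  assume L: "lcc S g"
  show ?R
  proof (intro ballI allI impI)
    fix x q and e :: real assume x: "x \<in> S" and q: "CS q" and e: "e > 0"
    have "openin (top_of_set S) {x' \<in> topspace (top_of_set S). g x' \<in> {z. q (z - g x) < e}}"
      using openin_continuous_map_preimage[OF L openin_CS_ball[OF q]] .
    moreover have "q (g x - g x) < e" using cseminorm_zero[OF CS_cseminorm[OF q]] e by simp
    ultimately show "\<exists>d>0. \<forall>x'\<in>S. dist x' x < d \<longrightarrow> q (g x' - g x) < e"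
      using x unfolding openin_euclidean_subtopology_iff by simp
  qed
next
  assume R: ?R
  show "lcc S g" unfolding continuous_map_def
  proof (intro conjI allI impI)
    fix U assume U: "openin T U"
    show "openin (top_of_set S) {x \<in> topspace (top_of_set S). g x \<in> U}"
      unfolding openin_euclidean_subtopology_iff
    proof (intro conjI ballI)
      fix x assume x: "x \<in> {x \<in> topspace (top_of_set S). g x \<in> U}"
      then obtain q where q: "CS q" "\<forall>z. q (z - g x) < 1 \<longrightarrow> z \<in> U"
        using U unfolding openin_iff_CS by blast
      obtain d where "d > 0" "\<forall>x'\<in>S. dist x' x < d \<longrightarrow> q (g x' - g x) < 1"
        using R[rule_format, OF _ q(1) zero_less_one, of x] x by auto
      then show "\<exists>e>0. \<forall>x'\<in>S. dist x' x < e \<longrightarrow> x' \<in> {x \<in> topspace (top_of_set S). g x \<in> U}"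
        using q by auto
    qed auto
  qed simp
qed

lemma lccD:
  assumes "lcc S g" "x \<in> S" "CS q" "e > 0"
  obtains d where "d > 0" "\<And>x'. x' \<in> S \<Longrightarrow> dist x' x < d \<Longrightarrow> q (g x' - g x) < e"
  using assms unfolding lcc_iff by meson

lemma lcc_subset: "lcc S g \<Longrightarrow> S' \<subseteq> S \<Longrightarrow> lcc S' g"
  by (metis continuous_map_from_subtopology inf.absorb_iff2 subtopology_subtopology)

lemma lcc_compose:
  assumes "lcc S g" "continuous_on S' h" "h ` S' \<subseteq> S"
  shows "lcc S' (\<lambda>x. g (h x))"
  using continuous_map_compose[of "top_of_set S'" "top_of_set S" h T g] assms
  by (auto simp: o_def continuous_map_in_subtopology)

lemma lcc_const: "lcc S (\<lambda>x. c)"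
  by simp

lemma lcc_add:
  assumes f: "lcc S f" and g: "lcc S g"
  shows "lcc S (\<lambda>x. f x + g x)"
  unfolding lcc_iff
proof (intro ballI allI impI)
  fix x q and e :: real assume x: "x \<in> S" and q: "CS q" and e: "e > 0"
  obtain d1 where d1: "d1 > 0" "\<And>x'. x' \<in> S \<Longrightarrow> dist x' x < d1 \<Longrightarrow> q (f x' - f x) < e/2"
    using lccD[OF f x q, of "e/2"] e by auto
  obtain d2 where d2: "d2 > 0" "\<And>x'. x' \<in> S \<Longrightarrow> dist x' x < d2 \<Longrightarrow> q (g x' - g x) < e/2"
    using lccD[OF g x q, of "e/2"] e by auto
  have "q (f x' + g x' - (f x + g x)) < e" if "x' \<in> S" "dist x' x < min d1 d2" for x'
  proof -
    have "q (f x' + g x' - (f x + g x)) \<le> q (f x' - f x) + q (g x' - g x)"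
      using cseminorm_triangle[OF CS_cseminorm[OF q], of "f x' - f x" "g x' - g x"]
      by (simp add: algebra_simps)
    then show ?thesis using d1(2)[of x'] d2(2)[of x'] that by simp
  qed
  then show "\<exists>d>0. \<forall>x'\<in>S. dist x' x < d \<longrightarrow> q (f x' + g x' - (f x + g x)) < e"
    using d1(1) d2(1) by (intro exI[of _ "min d1 d2"]) auto
qed

lemma lcc_scale:
  assumes c: "continuous_on S c" and g: "lcc S g"
  shows "lcc S (\<lambda>x. sc (c x) (g x))"
  unfolding lcc_iff
proof (intro ballI allI impI)
  fix x q and e :: real assume x: "x \<in> S" and q: "CS q" and e: "e > 0"
  \<comment> \<open>One bound for both factors: it dominates \<open>q (g x)\<close> and, once
    \<open>c x'\<close> is within 1 of \<open>c x\<close>, also \<open>cmod (c x')\<close>.\<close>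
  define M where "M = cmod (c x) + 1 + q (g x)"
  have qn: "0 \<le> q y" for y using cseminorm_nonneg[OF CS_cseminorm[OF q]] .
  have M: "M > 0" using qn[of "g x"] norm_ge_zero[of "c x"] unfolding M_def by linarith
  obtain d1 where d1: "d1 > 0" "\<And>x'. x' \<in> S \<Longrightarrow> dist x' x < d1 \<Longrightarrow> q (g x' - g x) < e/(2*M)"
    using lccD[OF g x q, of "e/(2*M)"] e M by auto
  have "\<exists>d>0. \<forall>x'\<in>S. dist x' x < d \<longrightarrow> dist (c x') (c x) < min 1 (e/(2*M))"
    using c[unfolded continuous_on_iff, rule_format, OF x, of "min 1 (e/(2*M))"] e M by simp
  then obtain d2 where d2: "d2 > 0"
    "\<And>x'. x' \<in> S \<Longrightarrow> dist x' x < d2 \<Longrightarrow> dist (c x') (c x) < min 1 (e/(2*M))" by blast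
  have "q (sc (c x') (g x') - sc (c x) (g x)) < e" if x': "x' \<in> S" "dist x' x < min d1 d2" for x'
  proof -
    have cc: "cmod (c x' - c x) < 1" "cmod (c x' - c x) \<le> e/(2*M)"
      using d2(2)[of x'] x' by (auto simp: dist_norm)
    have c': "cmod (c x') \<le> M"
      using cc(1) norm_triangle_ineq2[of "c x'" "c x"] qn[of "g x"] unfolding M_def by linarith
    have "sc (c x') (g x') - sc (c x) (g x) = sc (c x') (g x' - g x) + sc (c x' - c x) (g x)"
      by (simp add: scale_right_diff_distrib scale_left_diff_distrib)
    then have "q (sc (c x') (g x') - sc (c x) (g x))
        \<le> cmod (c x') * q (g x' - g x) + cmod (c x' - c x) * q (g x)"
      using cseminorm_triangle[OF CS_cseminorm[OF q], of "sc (c x') (g x' - g x)" "sc (c x' - c x) (g x)"]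
      by (simp add: cseminorm_scale[OF CS_cseminorm[OF q]])
    also have "cmod (c x') * q (g x' - g x) \<le> M * q (g x' - g x)"
      by (rule mult_right_mono[OF c' qn])
    also have "M * q (g x' - g x) < M * (e/(2*M))"
      using d1(2)[of x'] x' M by (intro mult_strict_left_mono) auto
    also have "cmod (c x' - c x) * q (g x) \<le> (e/(2*M)) * M"
      using cc(2) qn[of "g x"] e M by (intro mult_mono) (auto simp: M_def)
    finally show ?thesis using M by simp
  qed
  then show "\<exists>d>0. \<forall>x'\<in>S. dist x' x < d \<longrightarrow> q (sc (c x') (g x') - sc (c x) (g x)) < e"
    using d1(1) d2(1) by (intro exI[of _ "min d1 d2"]) auto
qed

lemma lcc_sum:
  "finite I \<Longrightarrow> (\<And>i. i \<in> I \<Longrightarrow> lcc S (g i)) \<Longrightarrow> lcc S (\<lambda>x. \<Sum>i\<in>I. g i x)"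
proof (induction I rule: finite_induct)
  case (insert i I)
  then show ?case by (simp add: lcc_add)
qed simp

lemma lcc_CS: "lcc S g \<Longrightarrow> CS q \<Longrightarrow> continuous_on S (\<lambda>x. q (g x))"
  using continuous_map_compose[of "top_of_set S" T g euclidean q]
  by (simp add: cont_seminorm_def o_def)

lemma lcc_dual: "lcc S g \<Longrightarrow> \<phi> \<in> dual_space sc P \<Longrightarrow> continuous_on S (\<lambda>x. \<phi> (g x))"
  using continuous_map_compose[of "top_of_set S" T g euclidean \<phi>]
  by (simp add: dual_space_def o_def)

lemma lcc_cGhol:
  assumes "lcc S g" "cGhol sc P D \<psi>" "g ` S \<subseteq> D"
  shows "continuous_on S (\<lambda>x. \<psi> (g x))"
proof -
  have "continuous_map (top_of_set S) (subtopology T D) g"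
    using assms by (auto simp: continuous_map_in_subtopology)
  then have "continuous_map (top_of_set S) euclidean (\<psi> \<circ> g)"
    using assms(2) by (intro continuous_map_compose[of _ "subtopology T D"]) (simp_all add: cGhol_def)
  then show ?thesis by (simp add: o_def)
qed

text \<open>A Lebesgue-number argument: finitely many local choices of seminorm along the compact
  image add up to one that works at every point, so the tube has a uniform width. Later it provides
  both neighbourhoods inside \<open>D\<close> and uniform continuity of functions on
  \<open>D\<close>.\<close>

lemma tube:
  fixes g :: "'a::metric_space \<Rightarrow> 'y" and h :: "'y \<Rightarrow> 'b::metric_space"
  assumes S: "compact S" and g: "lcc S g" "g ` S \<subseteq> D"
    and h: "continuous_map (subtopology T D) euclidean h" "openin T D" and e: "e > 0"
  obtains q where "CS q" "\<And>x z. x \<in> S \<Longrightarrow> q (z - g x) < 1 \<Longrightarrow> z \<in> D \<and> dist (h z) (h (g x)) < e"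
proof -
  have "\<exists>q. CS q \<and> (\<forall>z. q (z - g x) < 1 \<longrightarrow> z \<in> D \<and> dist (h z) (h (g x)) < e/2)" if "x \<in> S" for x
    using continuous_map_lcD[OF h, of "g x" "e/2"] that g(2) e by (metis half_gt_zero image_subset_iff)
  then obtain Q where Q: "\<And>x. x \<in> S \<Longrightarrow> CS (Q x)"
    "\<And>x z. x \<in> S \<Longrightarrow> Q x (z - g x) < 1 \<Longrightarrow> z \<in> D \<and> dist (h z) (h (g x)) < e/2" by metis
  have "\<exists>d>0. \<forall>x'\<in>S. dist x' x < d \<longrightarrow> Q x (g x' - g x) < 1/2" if "x \<in> S" for x
    using lccD[OF g(1) that Q(1)[OF that], of "1/2"] by (metis half_gt_zero zero_less_one)
  then obtain d where d: "\<And>x. x \<in> S \<Longrightarrow> d x > 0"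
    "\<And>x x'. x \<in> S \<Longrightarrow> x' \<in> S \<Longrightarrow> dist x' x < d x \<Longrightarrow> Q x (g x' - g x) < 1/2" by metis
  have "S \<subseteq> (\<Union>x\<in>S. ball x (d x))" using d(1) by force
  then obtain I where I: "I \<subseteq> S" "finite I" "S \<subseteq> (\<Union>x\<in>I. ball x (d x))"
    using compactE_image[OF S, of S "\<lambda>x. ball x (d x)"] by auto
  \<comment> \<open>The factor 2 makes \<open>q < 1\<close> force \<open>Q i < 1/2\<close>; the
    other half is spent on moving from \<open>g x\<close> to the centre \<open>g i\<close>.\<close>
  define q where "q = (\<lambda>y. \<Sum>x\<in>I. 2 * Q x y)"
  have "CS q" unfolding q_def by (rule CS_sum) (use I Q CS_mult in auto)
  moreover have "z \<in> D \<and> dist (h z) (h (g x)) < e" if x: "x \<in> S" and z: "q (z - g x) < 1" for x z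
  proof -
    obtain i where i: "i \<in> I" "dist x i < d i" using I(3) x by (auto simp: dist_commute)
    have iS: "i \<in> S" using i I by blast
    have nn: "0 \<le> Q j y" if "j \<in> I" for j y
      using cseminorm_nonneg[OF CS_cseminorm[OF Q(1)]] that I by blast
    have "2 * Q i (z - g x) \<le> q (z - g x)"
      unfolding q_def using i I nn by (intro member_le_sum) auto
    then have 1: "Q i (z - g x) < 1/2" using z by simp
    have 2: "Q i (g x - g i) < 1/2" using d(2)[OF iS x i(2)] .
    have "Q i (z - g i) < 1"
      using 1 2 cseminorm_diff_triangle[OF CS_cseminorm[OF Q(1)[OF iS]], of z "g i" "g x"] by simp
    then have 3: "z \<in> D" "dist (h z) (h (g i)) < e/2" using Q(2)[OF iS] by auto
    have "dist (h (g x)) (h (g i)) < e/2" using Q(2)[OF iS, of "g x"] 2 by auto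
    then show ?thesis using 3 dist_triangle_half_l[of "h z" "h (g i)" e "h (g x)"]
      by (auto simp: dist_commute)
  qed
  ultimately show ?thesis using that by blast
qed

lemma tube_open:
  fixes g :: "'a::metric_space \<Rightarrow> 'y"
  assumes S: "compact S" and g: "lcc S g" "g ` S \<subseteq> D" and D: "openin T D"
  obtains q where "CS q" "\<And>x z. x \<in> S \<Longrightarrow> q (z - g x) < 1 \<Longrightarrow> z \<in> D"
  using tube[OF S g _ D zero_less_one, of "\<lambda>_. 0::real"] by auto

section \<open>Closures, the dual space and separation in Y\<close>

lemma in_closure_iff:
  "y \<in> T closure_of K \<longleftrightarrow> (\<forall>q. CS q \<longrightarrow> (\<exists>k\<in>K. q (k - y) < 1))"
proof -
  have "(\<exists>k. k \<in> K \<and> k \<in> U)" if R: "\<forall>q. CS q \<longrightarrow> (\<exists>k\<in>K. q (k - y) < 1)" and U: "y \<in> U" "openin T U" for U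
  proof -
    obtain q where "CS q" "\<forall>z. q (z - y) < 1 \<longrightarrow> z \<in> U" using U unfolding openin_iff_CS by blast
    then show ?thesis using R by blast
  qed
  moreover have "\<exists>k\<in>K. q (k - y) < 1" if L: "y \<in> T closure_of K" and q: "CS q" for q
  proof -
    have "y \<in> {z. q (z - y) < 1}" using cseminorm_zero[OF CS_cseminorm[OF q]] by simp
    then have "\<exists>k. k \<in> K \<and> k \<in> {z. q (z - y) < 1}"
      by (rule L[unfolded in_closure_of, THEN conjunct2, rule_format, OF conjI[OF _ openin_CS_ball[OF q, of y 1]]])
    then show ?thesis by blast
  qed
  ultimately show ?thesis unfolding in_closure_of by auto
qed

lemma dual_I:
  assumes lin: "Vector_Spaces.linear sc (*) \<phi>" and q: "CS q" and le: "\<And>y. cmod (\<phi> y) \<le> q y"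
  shows "\<phi> \<in> dual_space sc P"
proof -
  have diff: "\<phi> (x - y) = \<phi> x - \<phi> y" for x y
    using module_hom.diff[of sc "(*)" \<phi>] lin unfolding module_hom_iff_linear by blast
  have "continuous_map (subtopology T UNIV) euclidean \<phi>"
  proof (rule continuous_map_lcI)
    show "openin T UNIV" using openin_topspace[of T] by simp
    fix y :: 'y and e :: real assume e: "e > 0"
    have "dist (\<phi> z) (\<phi> y) < e" if "(1/e) * q (z - y) < 1" for z
      using le[of "z - y"] that e by (simp add: dist_norm diff field_simps)
    then show "\<exists>q. CS q \<and> (\<forall>z\<in>UNIV. q (z - y) < 1 \<longrightarrow> dist (\<phi> z) (\<phi> y) < e)"
      using CS_mult[OF q, of "1/e"] e by (intro exI[of _ "\<lambda>y. (1/e) * q y"]) auto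
  qed
  then show ?thesis using lin by (simp add: dual_space_def)
qed

lemma dual_add: "\<phi> \<in> dual_space sc P \<Longrightarrow> \<phi> (x + y) = \<phi> x + \<phi> y"
  and dual_diff: "\<phi> \<in> dual_space sc P \<Longrightarrow> \<phi> (x - y) = \<phi> x - \<phi> y"
  and dual_scale: "\<phi> \<in> dual_space sc P \<Longrightarrow> \<phi> (sc c x) = c * \<phi> x"
  using module_hom.diff[of sc "(*)" \<phi>] module_hom.add[of sc "(*)" \<phi>] module_hom.scale[of sc "(*)" \<phi>]
  unfolding module_hom_iff_linear dual_space_def by auto

text \<open>Separate x from the single point 0, which lies at q-distance \<open>q x\<close>. This
  turns bounds holding for all functionals dominated by q into a bound on q itself.\<close>

lemma norming_functional:
  assumes q: "CS q"
  obtains \<phi> where "\<phi> \<in> dual_space sc P" "\<And>y. cmod (\<phi> y) \<le> q y" "q x \<le> cmod (\<phi> x)"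
proof -
  have "q x \<le> q (k - x)" if "k \<in> {0}" for k
    using that cseminorm_minus[OF CS_cseminorm[OF q], of x] by simp
  then obtain \<phi> where \<phi>: "Vector_Spaces.linear sc (*) \<phi>" "\<And>y. cmod (\<phi> y) \<le> q y"
    "\<And>k. k \<in> {0} \<Longrightarrow> Re (\<phi> x) + q x \<le> Re (\<phi> k)"
    using complex_separation[OF CS_cseminorm[OF q], of "{0}" "q x" x] by auto
  have d: "\<phi> \<in> dual_space sc P" using dual_I[OF \<phi>(1) q \<phi>(2)] .
  have "Re (\<phi> x) + q x \<le> 0" using \<phi>(3)[of 0] dual_diff[OF d, of 0 0] by simp
  then have "q x \<le> cmod (\<phi> x)" using abs_Re_le_cmod[of "\<phi> x"] by linarith
  then show ?thesis using that d \<phi>(2) by blast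
qed

text \<open>A point outside the closure has a whole seminorm unit ball free of \<open>K\<close>,
  that is, distance at least 1; hence a gap of 1 even though \<open>K\<close> itself need not be
  closed.\<close>

lemma closed_convex_separation:
  assumes y: "y \<notin> T closure_of K" and K0: "K \<noteq> {}"
    and conv: "\<And>k l s t. k \<in> K \<Longrightarrow> l \<in> K \<Longrightarrow> 0 \<le> s \<Longrightarrow> 0 \<le> t \<Longrightarrow> s + t = 1 \<Longrightarrow>
                 sc (of_real s) k + sc (of_real t) l \<in> K"
  obtains \<phi> where "\<phi> \<in> dual_space sc P" "\<And>k. k \<in> K \<Longrightarrow> Re (\<phi> y) + 1 \<le> Re (\<phi> k)"
proof -
  obtain q where q: "CS q" "\<And>k. k \<in> K \<Longrightarrow> 1 \<le> q (k - y)"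
    using y unfolding in_closure_iff by (meson not_less)
  obtain \<phi> where \<phi>: "Vector_Spaces.linear sc (*) \<phi>" "\<And>y. cmod (\<phi> y) \<le> q y"
    "\<And>k. k \<in> K \<Longrightarrow> Re (\<phi> y) + 1 \<le> Re (\<phi> k)"
  proof (rule complex_separation[OF CS_cseminorm[OF q(1)] K0, of 1 y])
    show "sc (of_real s) k + sc (of_real t) l \<in> K"
      if "k \<in> K" "l \<in> K" "0 \<le> s" "0 \<le> t" "s + t = 1" for k l s t
      by (rule conv[OF that])
    show "1 \<le> q (k - y)" if "k \<in> K" for k by (rule q(2)[OF that])
  qed blast
  show ?thesis
    by (rule that[OF dual_I[OF \<phi>(1) q(1) \<phi>(2)] \<phi>(3)])
qed

text \<open>The ball is star-shaped about its centre. Connectedness matters because the larger set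
  \<open>D1\<close> in the definition of a domain of holomorphy has to be connected.\<close>

lemma connectedin_CS_ball:
  assumes q: "CS q" shows "connectedin T {z. q (z - y) < 1}"
proof -
  define L where "L = (\<lambda>z. (\<lambda>t::real. y + sc (of_real t) (z - y)) ` {0..1})"
  have "connectedin T (L z)" for z
    unfolding L_def
  proof (rule connectedin_continuous_map_image)
    show "lcc UNIV (\<lambda>t::real. y + sc (of_real t) (z - y))"
      by (intro lcc_add lcc_scale lcc_const continuous_intros)
    show "connectedin (top_of_set UNIV) {0..1::real}" by simp
  qed
  moreover have "y \<in> L z" for z unfolding L_def by (auto intro!: image_eqI[of _ _ 0])
  then have "y \<in> \<Inter>(L ` {z. q (z - y) < 1})" by blast
  ultimately have "connectedin T (\<Union>(L ` {z. q (z - y) < 1}))"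
    by (intro connectedin_Union) blast+
  moreover have "\<Union>(L ` {z. q (z - y) < 1}) = {z. q (z - y) < 1}"
  proof (intro equalityI subsetI)
    fix w assume "w \<in> \<Union>(L ` {z. q (z - y) < 1})"
    then obtain z t where zt: "q (z - y) < 1" "0 \<le> t" "t \<le> 1" "w = y + sc (of_real t) (z - y)"
      unfolding L_def by auto
    have "q (w - y) = t * q (z - y)"
      using zt cseminorm_scale[OF CS_cseminorm[OF q], of "of_real t" "z - y"] by simp
    also have "\<dots> \<le> q (z - y)"
      using zt cseminorm_nonneg[OF CS_cseminorm[OF q], of "z - y"] by (simp add: mult_left_le_one_le)
    finally show "w \<in> {z. q (z - y) < 1}" using zt by simp
  next
    fix z assume z: "z \<in> {z. q (z - y) < 1}"
    have "z \<in> L z" unfolding L_def by (auto intro!: image_eqI[of _ _ 1])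
    then show "z \<in> \<Union>(L ` {z. q (z - y) < 1})" using z by blast
  qed
  ultimately show ?thesis by simp
qed

end

section \<open>Holomorphic curves\<close>

text \<open>Swapping the two contour integrals shows that the integral satisfies Cauchy's formula on
  every small circle in \<open>U\<close>, and continuous functions given by that formula are
  differentiable. This avoids any control of the z-derivative of \<open>G\<close>.\<close>

lemma contour_integral_param_holomorphic:
  fixes G :: "complex \<Rightarrow> complex \<Rightarrow> complex"
  assumes U: "open U"
    and cont: "continuous_on (U \<times> path_image (circlepath c \<delta>)) (\<lambda>(z, u). G z u)"
    and hol: "\<And>u. u \<in> path_image (circlepath c \<delta>) \<Longrightarrow> (\<lambda>z. G z u) holomorphic_on U"
    and contI: "continuous_on U (\<lambda>z. contour_integral (circlepath c \<delta>) (G z))"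
  shows "(\<lambda>z. contour_integral (circlepath c \<delta>) (G z)) holomorphic_on U"
proof -
  define \<Phi> where "\<Phi> = (\<lambda>z. contour_integral (circlepath c \<delta>) (G z))"
  have int: "G z contour_integrable_on circlepath c \<delta>" if z: "z \<in> U" for z
  proof (rule contour_integrable_continuous_circlepath)
    have "continuous_on (path_image (circlepath c \<delta>)) (\<lambda>u. (\<lambda>(z, u). G z u) (z, u))"
      by (rule continuous_on_compose2[OF cont]) (use z in \<open>auto intro!: continuous_intros\<close>)
    then show "continuous_on (path_image (circlepath c \<delta>)) (G z)" by simp
  qed
  have "\<Phi> field_differentiable (at z0)" if z0: "z0 \<in> U" for z0
  proof -
    obtain r where r: "r > 0" "cball z0 r \<subseteq> U" using U z0 open_contains_cball by metis
    let ?c = "circlepath z0 r"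
    have im: "path_image ?c \<subseteq> U" using r by auto
    \<comment> \<open>The exponent 1 fits the shape of
      \<open>Cauchy_next_derivative_circlepath\<close>, which raises it by one and delivers the
      derivative.\<close>
    have "((\<lambda>u. \<Phi> u / (u - w)^1) has_contour_integral (2 * of_real pi * \<i> * \<Phi> w)) ?c"
      if w: "w \<in> ball z0 r" for w
    proof -
      have nz: "u - w \<noteq> 0" if "u \<in> path_image ?c" for u using that w r by (auto simp: dist_commute)
      have ci: "contour_integral ?c (\<lambda>z. G z u / (z - w)) = 2 * of_real pi * \<i> * G w u"
        if u: "u \<in> path_image (circlepath c \<delta>)" for u
      proof (rule contour_integral_unique, rule Cauchy_integral_circlepath)
        show "continuous_on (cball z0 r) (\<lambda>z. G z u)"
          using hol[OF u] r(2) by (meson holomorphic_on_imp_continuous_on holomorphic_on_subset)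
        show "(\<lambda>z. G z u) holomorphic_on ball z0 r"
          using hol[OF u] r(2) ball_subset_cball by (meson holomorphic_on_subset subset_trans)
        show "cmod (w - z0) < r" using w by (simp add: dist_norm norm_minus_commute)
      qed
      have "contour_integral ?c (\<lambda>z. \<Phi> z / (z - w))
          = contour_integral ?c (\<lambda>z. contour_integral (circlepath c \<delta>) (\<lambda>u. G z u / (z - w)))"
        unfolding \<Phi>_def by (rule contour_integral_eq) (use im in \<open>auto intro!: contour_integral_div[symmetric] int\<close>)
      also have "\<dots> = contour_integral (circlepath c \<delta>) (\<lambda>u. contour_integral ?c (\<lambda>z. G z u / (z - w)))"
      proof (rule contour_integral_swap)
        have "continuous_on (path_image ?c \<times> path_image (circlepath c \<delta>)) (\<lambda>p. (\<lambda>(z, u). G z u) p / (fst p - w))"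
          using nz im by (intro continuous_intros continuous_on_subset[OF cont]) auto
        then show "continuous_on (path_image ?c \<times> path_image (circlepath c \<delta>)) (\<lambda>(y1, y2). G y1 y2 / (y1 - w))"
          by (simp add: case_prod_unfold)
      qed (auto simp: vector_derivative_circlepath intro!: continuous_intros)
      also have "\<dots> = contour_integral (circlepath c \<delta>) (\<lambda>u. 2 * of_real pi * \<i> * G w u)"
        by (rule contour_integral_eq) (rule ci)
      also have "\<dots> = 2 * of_real pi * \<i> * \<Phi> w"
        unfolding \<Phi>_def by (rule contour_integral_lmul[OF int]) (use w r in force)
      finally have "contour_integral ?c (\<lambda>z. \<Phi> z / (z - w)) = 2 * of_real pi * \<i> * \<Phi> w" .
      moreover have "(\<lambda>z. \<Phi> z / (z - w)) contour_integrable_on ?c"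
        using nz im contI unfolding \<Phi>_def
        by (intro contour_integrable_continuous_circlepath continuous_intros) (auto intro: continuous_on_subset)
      ultimately show ?thesis using has_contour_integral_integral by fastforce
    qed
    from Cauchy_next_derivative_circlepath(2)[OF _ this, of z0]
    have "((\<lambda>z. 2 * of_real pi * \<i> * \<Phi> z) has_field_derivative
            (of_nat 1 * contour_integral ?c (\<lambda>u. \<Phi> u/(u-z0)^(Suc 1)))) (at z0)"
      using im contI r unfolding \<Phi>_def by (auto intro: continuous_on_subset)
    then have "(\<lambda>z. 2 * of_real pi * \<i> * \<Phi> z) field_differentiable (at z0)"
      unfolding field_differentiable_def by blast
    then have "(\<lambda>z. (1 / (2 * of_real pi * \<i>)) * (2 * of_real pi * \<i> * \<Phi> z)) field_differentiable (at z0)"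
      by (rule field_differentiable_mult[OF field_differentiable_const])
    moreover have "(\<lambda>z. (1 / (2 * of_real pi * \<i>)) * (2 * of_real pi * \<i> * \<Phi> z)) = \<Phi>"
      by (rule ext) simp
    ultimately show ?thesis by metis
  qed
  then show ?thesis
    unfolding holomorphic_on_def \<Phi>_def using field_differentiable_at_within by blast
qed

locale sc_lc_space = lc_space +
  assumes haus: "Hausdorff_space T"
    and complete: "\<And>s :: nat \<Rightarrow> 'a. (\<And>p e. p \<in> P \<Longrightarrow> e > 0 \<Longrightarrow> \<exists>N. \<forall>m\<ge>N. \<forall>n\<ge>N. p (s m - s n) < e) \<Longrightarrow>
       \<exists>y. limitin T s y sequentially"
begin

lemma P_CS: "p \<in> P \<Longrightarrow> CS p"
  by (rule CS_I[of p "{p}" 1]) (use seminorms in auto)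

lemma CS_separating:
  assumes "y \<noteq> 0" obtains q where "CS q" "q y \<ge> 1"
proof -
  obtain U V where UV: "openin T U" "openin T V" "y \<in> U" "0 \<in> V" "disjnt U V"
    using haus[unfolded Hausdorff_space_def, rule_format, of y 0] assms by auto
  then obtain q where "CS q" "\<forall>z. q (z - 0) < 1 \<longrightarrow> z \<in> V" unfolding openin_iff_CS by blast
  moreover from this have "1 \<le> q y" using UV by (metis diff_zero disjnt_iff not_less)
  ultimately show ?thesis using that by blast
qed

text \<open>Weak holomorphy becomes strong differentiability. For functionals bounded by q, all
  Taylor remainders are controlled by a bound of q along the curve on a compact disc, uniformly in
  the functional; a norming functional then makes the difference quotients Cauchy for q. Sequential
  completeness gives the limit.\<close>

lemma weakly_holomorphic_derivative:
  assumes S: "open S" and cont: "lcc S \<gamma>"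
    and hol: "\<And>\<phi>. \<phi> \<in> dual_space sc P \<Longrightarrow> (\<lambda>z. \<phi> (\<gamma> z)) holomorphic_on S"
    and z0: "z0 \<in> S"
  obtains d where "\<forall>q e. CS q \<longrightarrow> e > 0 \<longrightarrow>
    (\<exists>r>0. \<forall>t. 0 < cmod t \<and> cmod t < r \<longrightarrow> q (sc (1/t) (\<gamma> (z0 + t) - \<gamma> z0) - d) < e)"
proof -
  obtain R where R: "R > 0" "cball z0 R \<subseteq> S" using S z0 open_contains_cball by metis
  \<comment> \<open>Half the radius leaves room for a circle of radius r about every point of the
    smaller disc, where Cauchy's inequality is applied.\<close>
  define r where "r = R / 2"
  have r: "r > 0" "r + r = R" using R by (auto simp: r_def)
  define Q where "Q = (\<lambda>t. sc (1/t) (\<gamma> (z0 + t) - \<gamma> z0))"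
  have "\<exists>B\<ge>0. \<forall>t t'. 0 < cmod t \<and> cmod t \<le> r \<longrightarrow> 0 < cmod t' \<and> cmod t' \<le> r \<longrightarrow>
      q (Q t - Q t') \<le> B * (cmod t + cmod t')" if q: "CS q" for q
  proof -
    have "compact ((\<lambda>z. q (\<gamma> z)) ` cball z0 R)"
      using lcc_CS[OF lcc_subset[OF cont R(2)] q] by (intro compact_continuous_image) auto
    then obtain M where M: "\<And>z. z \<in> cball z0 R \<Longrightarrow> \<bar>q (\<gamma> z)\<bar> \<le> M"
      using compact_imp_bounded bounded_real by (metis imageI)
    have M0: "0 \<le> M" using M[of z0] R by fastforce
    \<comment> \<open>Cauchy's bound for the second derivative, which governs the first-order Taylor
      remainder.\<close>
    define B where "B = 2 * M / r^2"
    have est: "cmod (\<phi> (Q t) - deriv (\<lambda>z. \<phi> (\<gamma> z)) z0) \<le> B * cmod t"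
      if \<phi>: "\<phi> \<in> dual_space sc P" "\<And>y. cmod (\<phi> y) \<le> q y" and t: "0 < cmod t" "cmod t \<le> r" for \<phi> t
    proof -
      let ?h = "\<lambda>z. \<phi> (\<gamma> z)"
      have holS: "?h holomorphic_on S" using hol \<phi> by blast
      have der: "((deriv ^^ i) ?h has_field_derivative (deriv ^^ Suc i) ?h x) (at x within cball z0 r)"
        if "x \<in> cball z0 r" for i x
      proof -
        have "x \<in> S" using that R r by auto
        then show ?thesis
          using has_field_derivative_higher_deriv[OF holS S] has_field_derivative_at_within by blast
      qed
      have b: "cmod ((deriv ^^ Suc 1) ?h x) \<le> B" if x: "x \<in> cball z0 r" for x
      proof -
        have sub: "cball x r \<subseteq> cball z0 R"
          using x r by (smt (verit) dist_triangle mem_cball subsetI)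
        have "cmod ((deriv ^^ 2) ?h x) \<le> fact 2 * M / r^2"
        proof (rule Cauchy_inequality)
          show "?h holomorphic_on ball x r"
            using holS sub R(2) ball_subset_cball by (meson holomorphic_on_subset subset_trans)
          show "continuous_on (cball x r) ?h"
            using holS sub R(2) by (meson holomorphic_on_imp_continuous_on holomorphic_on_subset subset_trans)
          show "cmod (?h y) \<le> M" if "cmod (x - y) = r" for y
          proof -
            have "y \<in> cball z0 R" using that sub by (auto simp: dist_norm)
            then show ?thesis using \<phi>(2)[of "\<gamma> y"] M[of y] by linarith
          qed
        qed (use r in auto)
        then show ?thesis by (simp add: B_def numeral_2_eq_2)
      qed
      have "cmod ((deriv ^^ 0) ?h (z0 + t) - (\<Sum>i\<le>1. (deriv ^^ i) ?h z0 * (z0 + t - z0) ^ i / fact i))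
          \<le> B * cmod (z0 + t - z0) ^ Suc 1 / fact 1"
        by (rule complex_Taylor[OF convex_cball der b]) (use t r in \<open>auto simp: dist_norm\<close>)
      then have "cmod (?h (z0 + t) - ?h z0 - deriv ?h z0 * t) \<le> B * (cmod t * cmod t)"
        by (simp add: algebra_simps power2_eq_square)
      then have "cmod (?h (z0 + t) - ?h z0 - deriv ?h z0 * t) / cmod t \<le> B * cmod t"
        using t by (simp add: field_simps)
      moreover have "\<phi> (Q t) - deriv ?h z0 = (?h (z0 + t) - ?h z0 - deriv ?h z0 * t) / t"
        using t by (simp add: Q_def dual_scale[OF \<phi>(1)] dual_diff[OF \<phi>(1)] field_simps)
      ultimately show ?thesis by (simp add: norm_divide)
    qed
    have "q (Q t - Q t') \<le> B * (cmod t + cmod t')"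
      if t: "0 < cmod t" "cmod t \<le> r" and t': "0 < cmod t'" "cmod t' \<le> r" for t t'
    proof -
      obtain \<phi> where \<phi>: "\<phi> \<in> dual_space sc P" "\<And>y. cmod (\<phi> y) \<le> q y" "q (Q t - Q t') \<le> cmod (\<phi> (Q t - Q t'))"
        using norming_functional[OF q, of "Q t - Q t'"] by blast
      have "cmod (\<phi> (Q t) - \<phi> (Q t')) \<le> B * cmod t + B * cmod t'"
        using norm_triangle_ineq4[of "\<phi> (Q t) - deriv (\<lambda>z. \<phi> (\<gamma> z)) z0" "\<phi> (Q t') - deriv (\<lambda>z. \<phi> (\<gamma> z)) z0"]
          est[OF \<phi>(1,2) t] est[OF \<phi>(1,2) t'] by simp
      then show ?thesis using \<phi>(3) by (simp add: dual_diff[OF \<phi>(1)] distrib_left)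
    qed
    moreover have "0 \<le> B" using M0 by (simp add: B_def)
    ultimately show ?thesis by blast
  qed
  then obtain B where B0: "\<And>q. CS q \<Longrightarrow> 0 \<le> B q"
    and B: "\<And>q t t'. CS q \<Longrightarrow> 0 < cmod t \<Longrightarrow> cmod t \<le> r \<Longrightarrow> 0 < cmod t' \<Longrightarrow> cmod t' \<le> r \<Longrightarrow>
      q (Q t - Q t') \<le> B q * (cmod t + cmod t')" by metis
  \<comment> \<open>Completeness speaks of sequences, so the limit is first taken along these
    non-zero increments, all of modulus at most r.\<close>
  define \<tau> where "\<tau> = (\<lambda>n. complex_of_real (r / real (Suc n)))"
  have \<tau>: "0 < cmod (\<tau> n)" "cmod (\<tau> n) \<le> r" for n
    using r by (auto simp: \<tau>_def norm_divide field_simps simp del: of_nat_Suc)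
  have \<tau>0: "(\<lambda>n. cmod (\<tau> n)) \<longlonglongrightarrow> 0"
  proof -
    have "(\<lambda>n. r * inverse (real (Suc n))) \<longlonglongrightarrow> r * 0"
      by (intro tendsto_mult tendsto_const LIMSEQ_inverse_real_of_nat)
    moreover have "cmod (\<tau> n) = r * inverse (real (Suc n))" for n
      unfolding \<tau>_def norm_of_real using r by (simp add: divide_inverse)
    ultimately show ?thesis by simp
  qed
  have small: "\<exists>N. \<forall>n\<ge>N. B q * cmod (\<tau> n) < e" if "e > 0" for q e
  proof -
    have "(\<lambda>n. B q * cmod (\<tau> n)) \<longlonglongrightarrow> B q * 0" using \<tau>0 by (intro tendsto_mult tendsto_const)
    then show ?thesis using order_tendstoD(2)[of _ 0 sequentially e] that
      by (simp add: eventually_sequentially)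
  qed
  have "\<exists>d. limitin T (\<lambda>n. Q (\<tau> n)) d sequentially"
  proof (rule complete)
    fix p and e :: real assume p: "p \<in> P" and e: "e > 0"
    obtain N where N: "\<And>n. n \<ge> N \<Longrightarrow> B p * cmod (\<tau> n) < e/2" using small[of "e/2"] e by auto
    have "p (Q (\<tau> m) - Q (\<tau> n)) < e" if "m \<ge> N" "n \<ge> N" for m n
      using B[OF P_CS[OF p] \<tau>[of m] \<tau>[of n]] N[OF that(1)] N[OF that(2)] by (simp add: distrib_left)
    then show "\<exists>N. \<forall>m\<ge>N. \<forall>n\<ge>N. p (Q (\<tau> m) - Q (\<tau> n)) < e" by blast
  qed
  then obtain d where d: "limitin T (\<lambda>n. Q (\<tau> n)) d sequentially" by blast
  \<comment> \<open>The difference quotient at any small t is compared with those along the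
    sequence, so the limit found there is the limit for all t, with a linear rate.\<close>
  have lim: "q (Q t - d) \<le> B q * cmod t" if q: "CS q" and t: "0 < cmod t" "cmod t \<le> r" for q t
  proof (rule field_le_epsilon)
    fix e :: real assume e: "e > 0"
    have "\<forall>\<^sub>F n in sequentially. Q (\<tau> n) \<in> {z. q (z - d) < e/2}"
      using d openin_CS_ball[OF q, of d "e/2"] cseminorm_zero[OF CS_cseminorm[OF q]] e
      unfolding limitin_def by (auto elim!: allE[of _ "{z. q (z - d) < e/2}"])
    then obtain N1 where N1: "\<And>n. n \<ge> N1 \<Longrightarrow> q (Q (\<tau> n) - d) < e/2"
      unfolding eventually_sequentially by auto
    obtain N2 where N2: "\<And>n. n \<ge> N2 \<Longrightarrow> B q * cmod (\<tau> n) < e/2" using small[of "e/2"] e by auto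
    define n where "n = max N1 N2"
    have "q (Q t - d) \<le> q (Q t - Q (\<tau> n)) + q (Q (\<tau> n) - d)"
      by (rule cseminorm_diff_triangle[OF CS_cseminorm[OF q]])
    also have "\<dots> \<le> B q * (cmod t + cmod (\<tau> n)) + e/2"
      using B[OF q t \<tau>[of n]] N1[of n] by (simp add: n_def)
    also have "\<dots> \<le> B q * cmod t + e" using N2[of n] by (simp add: n_def distrib_left)
    finally show "q (Q t - d) \<le> B q * cmod t + e" .
  qed
  show ?thesis
  proof (rule that, intro allI impI)
    fix q and e :: real assume q: "CS q" and e: "e > 0"
    have pos: "B q + 1 > 0" using B0[OF q] by simp
    have "q (sc (1/t) (\<gamma> (z0 + t) - \<gamma> z0) - d) < e"
      if t: "0 < cmod t" "cmod t < min r (e / (B q + 1))" for t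
    proof -
      have "B q * cmod t \<le> (B q + 1) * cmod t" by (simp add: mult_right_mono)
      also have "\<dots> < e" using t pos by (simp add: field_simps)
      finally show ?thesis using lim[OF q t(1)] t(2) by (simp add: Q_def)
    qed
    then show "\<exists>r>0. \<forall>t. 0 < cmod t \<and> cmod t < r \<longrightarrow> q (sc (1/t) (\<gamma> (z0 + t) - \<gamma> z0) - d) < e"
      using r e pos by (intro exI[of _ "min r (e / (B q + 1))"]) auto
  qed
qed

end

section \<open>The continuity principle\<close>

context lc_space
begin

lemma lcc_open_vimage:
  assumes "lcc UNIV g" "openin T U" shows "open {x. g x \<in> U}"
  using openin_continuous_map_preimage[OF assms] by simp

lemma lcc_line: "lcc S (\<lambda>z. a + sc z v)"
  by (intro lcc_add lcc_scale lcc_const continuous_intros)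

lemma cGhol_line:
  assumes D: "openin T D" and g: "cGhol sc P D g"
  shows "open {z. a + sc z v \<in> D}" "(\<lambda>z. g (a + sc z v)) holomorphic_on {z. a + sc z v \<in> D}"
proof -
  show op: "open {z. a + sc z v \<in> D}" by (rule lcc_open_vimage[OF lcc_line D])
  have "(\<lambda>z. g (a + sc z v)) field_differentiable (at s)" if s: "a + sc s v \<in> D" for s
  proof -
    obtain r where r: "r > 0" "(\<lambda>z. g ((a + sc s v) + sc z v)) holomorphic_on ball 0 r"
      using g s unfolding cGhol_def by blast
    then have "(\<lambda>z. g ((a + sc s v) + sc z v)) field_differentiable (at (s - s))"
      using holomorphic_on_imp_differentiable_at[OF r(2)] by simp
    then have "((\<lambda>z. g ((a + sc s v) + sc z v)) \<circ> (\<lambda>z. z - s)) field_differentiable (at s)"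
      by (intro field_differentiable_compose) (auto intro!: derivative_intros field_differentiable_diff)
    moreover have "((\<lambda>z. g ((a + sc s v) + sc z v)) \<circ> (\<lambda>z. z - s)) = (\<lambda>z. g (a + sc z v))"
      by (rule ext) (simp add: scale_left_diff_distrib)
    ultimately show ?thesis by simp
  qed
  then show "(\<lambda>z. g (a + sc z v)) holomorphic_on {z. a + sc z v \<in> D}"
    unfolding holomorphic_on_def using field_differentiable_at_within by blast
qed

end

text \<open>The Schwarz lemma after rescaling both discs. An error below e on a whole disc becomes
  an error proportional to \<open>cmod t\<close>, which survives division by t.\<close>

lemma Schwarz_scaled:
  assumes "f holomorphic_on ball 0 r" "f 0 = 0" "r > 0" "e > 0"
    and "\<And>z. cmod z < r \<Longrightarrow> cmod (f z) < e" and t: "cmod t < r"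
  shows "cmod (f t) \<le> e * cmod t / r"
proof -
  let ?g = "\<lambda>z. f (of_real r * z) / of_real e"
  have "cmod (?g (t / of_real r)) \<le> cmod (t / of_real r)"
  proof (rule Schwarz_Lemma(1))
    have "(f \<circ> (\<lambda>z. of_real r * z)) holomorphic_on ball 0 1"
      by (rule holomorphic_on_compose_gen[OF _ assms(1)])
         (use assms(3) in \<open>auto intro!: holomorphic_intros simp: norm_mult\<close>)
    then show "?g holomorphic_on ball 0 1"
      using assms(4) by (intro holomorphic_intros) (auto simp: o_def)
    show "cmod (?g z) < 1" if "cmod z < 1" for z
      using assms(3,4) assms(5)[of "of_real r * z"] that by (simp add: norm_mult norm_divide)
  qed (use assms in \<open>auto simp: norm_divide\<close>)
  then show ?thesis using assms(3,4) by (simp add: norm_divide field_simps)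
qed

context sc_lc_space
begin

text \<open>With the difference quotient of the curve at hand, the values of g along the secant and
along the tangent at the same parameter differ by \<open>o(t)\<close>, by the Schwarz lemma.\<close>

lemma cGhol_compose:
  assumes S: "open S" and cont: "lcc S \<gamma>"
    and hol: "\<And>\<phi>. \<phi> \<in> dual_space sc P \<Longrightarrow> (\<lambda>z. \<phi> (\<gamma> z)) holomorphic_on S"
    and D: "openin T D" and g: "cGhol sc P D g" and im: "\<gamma> ` S \<subseteq> D"
  shows "(\<lambda>z. g (\<gamma> z)) holomorphic_on S"
proof -
  have "(\<lambda>z. g (\<gamma> z)) field_differentiable (at z0)" if z0: "z0 \<in> S" for z0
  proof -
    obtain d where d: "\<forall>q e. CS q \<longrightarrow> e > 0 \<longrightarrow>
      (\<exists>r>0. \<forall>t. 0 < cmod t \<and> cmod t < r \<longrightarrow> q (sc (1/t) (\<gamma> (z0 + t) - \<gamma> z0) - d) < e)"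
      by (rule weakly_holomorphic_derivative[OF S cont hol z0]) blast
    define A where "A = \<gamma> z0"
    define Q where "Q = (\<lambda>t. sc (1/t) (\<gamma> (z0 + t) - \<gamma> z0))"
    have AD: "A \<in> D" using im z0 by (auto simp: A_def)
    define L where "L = {s. A + sc s d \<in> D}"
    have L: "open L" "0 \<in> L" using cGhol_line(1)[OF D g] AD by (auto simp: L_def)
    then obtain r where r: "r > 0" "cball 0 r \<subseteq> L" using open_contains_cball by metis
    have holL: "(\<lambda>s. g (A + sc s d)) holomorphic_on L"
      unfolding L_def by (rule cGhol_line(2)[OF D g])
    then obtain g1 where g1: "((\<lambda>s. g (A + sc s d)) has_field_derivative g1) (at 0)"
      using L holomorphic_on_imp_differentiable_at field_differentiable_def by blast
    have close: "\<exists>s>0. \<forall>t. t \<noteq> 0 \<and> dist t 0 < s \<longrightarrow>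
        dist ((g (\<gamma> (z0 + t)) - g (A + sc t d)) / t) 0 < \<eta>" if \<eta>: "\<eta> > 0" for \<eta>
    proof -
      \<comment> \<open>Chosen so that the Schwarz bound \<open>e * cmod t / r\<close> equals half
        of \<open>\<eta> * cmod t\<close>.\<close>
      define e where "e = \<eta> * r / 2"
      have e: "e > 0" using \<eta> r by (simp add: e_def)
      obtain q where q: "CS q" "\<And>s z. s \<in> cball 0 r \<Longrightarrow> q (z - (A + sc s d)) < 1 \<Longrightarrow>
          z \<in> D \<and> dist (g z) (g (A + sc s d)) < e"
      proof (rule tube[of "cball 0 r" "\<lambda>s. A + sc s d" D g e])
        show "(\<lambda>s. A + sc s d) ` cball 0 r \<subseteq> D" using r by (auto simp: L_def)
        show "continuous_map (subtopology T D) euclidean g" using g by (simp add: cGhol_def)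
      qed (use e D lcc_line in auto)
      \<comment> \<open>With this bound the secant and tangent lines differ by at most 1/2 in q for
        parameters up to r, so the secant stays inside the tube.\<close>
      obtain s where s: "s > 0" "\<And>t. 0 < cmod t \<Longrightarrow> cmod t < s \<Longrightarrow> q (Q t - d) < 1/(2*r)"
        using d[rule_format, OF q(1), of "1/(2*r)"] r unfolding Q_def by auto
      have "cmod ((g (\<gamma> (z0 + t)) - g (A + sc t d)) / t) < \<eta>" if t: "t \<noteq> 0" "cmod t < min r s" for t
      proof -
        \<comment> \<open>The secant direction \<open>Q t\<close> is frozen while z runs through the
          whole disc; at \<open>z = t\<close> the secant point is the curve point.\<close>
        have near: "A + sc z (Q t) \<in> D \<and> dist (g (A + sc z (Q t))) (g (A + sc z d)) < e"
          if z: "cmod z \<le> r" for z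
        proof (rule q(2))
          have "q (A + sc z (Q t) - (A + sc z d)) = cmod z * q (Q t - d)"
            by (simp add: cseminorm_scale[OF CS_cseminorm[OF q(1)], symmetric] scale_right_diff_distrib)
          also have "\<dots> \<le> r * (1/(2*r))"
            using z s(2)[of t] t r cseminorm_nonneg[OF CS_cseminorm[OF q(1)]]
            by (intro mult_mono) auto
          finally show "q (A + sc z (Q t) - (A + sc z d)) < 1" using r by simp
        qed (use z in simp)
        have "cmod (g (A + sc t (Q t)) - g (A + sc t d)) \<le> e * cmod t / r"
        proof (rule Schwarz_scaled[of "\<lambda>z. g (A + sc z (Q t)) - g (A + sc z d)" r e t])
          have "(\<lambda>z. g (A + sc z (Q t))) holomorphic_on ball 0 r"
            by (rule holomorphic_on_subset[OF cGhol_line(2)[OF D g, of A "Q t"]]) (use near in auto)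
          moreover have "(\<lambda>s. g (A + sc s d)) holomorphic_on ball 0 r"
            using holL r ball_subset_cball by (meson holomorphic_on_subset subset_trans)
          ultimately show "(\<lambda>z. g (A + sc z (Q t)) - g (A + sc z d)) holomorphic_on ball 0 r"
            by (rule holomorphic_on_diff)
        qed (use near r e t in \<open>auto simp: dist_norm\<close>)
        moreover have "A + sc t (Q t) = \<gamma> (z0 + t)" using t by (simp add: Q_def A_def)
        ultimately have "cmod (g (\<gamma> (z0 + t)) - g (A + sc t d)) \<le> (\<eta>/2) * cmod t"
          using r by (simp add: e_def)
        then have "cmod ((g (\<gamma> (z0 + t)) - g (A + sc t d)) / t) \<le> \<eta>/2"
          using t by (simp add: norm_divide field_simps)
        then show ?thesis using \<eta> by simp
      qed
      then show ?thesis using r s(1) by (intro exI[of _ "min r s"]) auto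
    qed
    then have "((\<lambda>t. (g (\<gamma> (z0 + t)) - g (A + sc t d)) / t) \<longlongrightarrow> 0) (at 0)"
      unfolding LIM_def by simp
    moreover have "((\<lambda>t. (g (A + sc t d) - g A) / t) \<longlongrightarrow> g1) (at 0)"
      using g1 by (simp add: DERIV_def)
    ultimately have "((\<lambda>t. (g (\<gamma> (z0 + t)) - g (A + sc t d)) / t + (g (A + sc t d) - g A) / t)
        \<longlongrightarrow> 0 + g1) (at 0)"
      by (rule tendsto_add)
    then have "((\<lambda>t. (g (\<gamma> (z0 + t)) - g A) / t) \<longlongrightarrow> g1) (at 0)"
      by (simp add: add_divide_distrib[symmetric])
    then have "((\<lambda>z. g (\<gamma> z)) has_field_derivative g1) (at z0)"
      by (simp add: DERIV_def A_def)
    then show ?thesis unfolding field_differentiable_def by blast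
  qed
  then show ?thesis
    unfolding holomorphic_on_def using field_differentiable_at_within by blast
qed

text \<open>Continuity principle. A function holomorphic near the closed disc extends to the translate
of the tube around the boundary circle by means of the Cauchy integral
\<open>v \<mapsto> (1 / 2\<pi>i) \<oint> g (\<gamma> \<zeta> + v) / \<zeta> d\<zeta>\<close>.\<close>

lemma domain_of_holomorphy_disc:
  assumes D: "domain_of_holomorphy sc P D" and \<delta>: "\<delta> > 0"
    and cont: "lcc (cball 0 \<delta>) \<gamma>"
    and hol: "\<And>\<phi>. \<phi> \<in> dual_space sc P \<Longrightarrow> (\<lambda>z. \<phi> (\<gamma> z)) holomorphic_on ball 0 \<delta>"
    and im: "\<gamma> ` cball 0 \<delta> \<subseteq> D"
    and q: "CS q" and tubeq: "\<And>u z. cmod u = \<delta> \<Longrightarrow> q (z - \<gamma> u) < 1 \<Longrightarrow> z \<in> D"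
    and z: "q (z - \<gamma> 0) < 1"
  shows "z \<in> D"
proof (rule ccontr)
  assume zD: "z \<notin> D"
  have oD: "openin T D" using D by (simp add: domain_of_holomorphy_def)
  define y where "y = \<gamma> 0"
  obtain q1 where q1: "CS q1" "\<And>u z. u \<in> cball 0 \<delta> \<Longrightarrow> q1 (z - \<gamma> u) < 1 \<Longrightarrow> z \<in> D"
    using tube_open[OF compact_cball cont im oD] by blast
  define D1 where "D1 = {z. q (z - y) < 1}"
  \<comment> \<open>For x in \<open>C\<close> the whole disc translated by \<open>x - y\<close>
    stays in \<open>D\<close>, not only its boundary circle, so Cauchy's formula gives
    \<open>h = g\<close> there.\<close>
  define C where "C = D1 \<inter> {z. q1 (z - y) < 1}"
  have oD1: "openin T D1" unfolding D1_def by (rule openin_CS_ball[OF q])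
  have oC: "openin T C" unfolding C_def by (intro openin_Int oD1 openin_CS_ball q1)
  have yC: "y \<in> C"
    using cseminorm_zero[OF CS_cseminorm[OF q]] cseminorm_zero[OF CS_cseminorm[OF q1(1)]]
    by (simp add: C_def D1_def)
  have CD: "C \<subseteq> D \<inter> D1"
    using q1(2)[of 0] \<delta> by (auto simp: C_def y_def)
  have con: "connectedin T D1" unfolding D1_def by (rule connectedin_CS_ball[OF q])
  have nsub: "\<not> D1 \<subseteq> D" using z zD by (auto simp: D1_def y_def)
  have "C \<noteq> {}" using yC by blast
  then have "\<not> (\<forall>g. cGhol sc P D g \<longrightarrow> (\<exists>h. cGhol sc P D1 h \<and> (\<forall>y\<in>C. h y = g y)))"
    using D[unfolded domain_of_holomorphy_def, THEN conjunct2, unfolded not_ex, THEN spec, THEN spec, of C D1]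
      oC oD1 CD con nsub by satx
  then obtain g where g: "cGhol sc P D g" and no: "\<And>h. cGhol sc P D1 h \<Longrightarrow> \<exists>y\<in>C. h y \<noteq> g y"
    by blast
  have gc: "continuous_map (subtopology T D) euclidean g" using g by (simp add: cGhol_def)
  define G where "G = (\<lambda>x u. g (\<gamma> u + (x - y)) / u)"
  define h where "h = (\<lambda>x. contour_integral (circlepath 0 \<delta>) (G x) / (2 * of_real pi * \<i>))"
  have sph: "path_image (circlepath 0 \<delta>) = sphere 0 \<delta>" using \<delta> by simp
  \<comment> \<open>For x in \<open>D1\<close> only the translated circle is known to lie in
    \<open>D\<close>, and the integral defining \<open>h\<close> sees nothing else.\<close>
  have inD: "\<gamma> u + (x - y) \<in> D" if "x \<in> D1" "u \<in> sphere 0 \<delta>" for x u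
    using tubeq[of u "\<gamma> u + (x - y)"] that by (simp add: D1_def)
  have cs: "lcc (sphere 0 \<delta>) \<gamma>" by (rule lcc_subset[OF cont]) auto
  have Gint: "G x contour_integrable_on circlepath 0 \<delta>" if x: "x \<in> D1" for x
  proof (rule contour_integrable_continuous_circlepath)
    have "continuous_on (sphere 0 \<delta>) (\<lambda>u. g (\<gamma> u + (x - y)))"
      by (rule lcc_cGhol[OF lcc_add[OF cs lcc_const] g]) (use inD x in auto)
    then show "continuous_on (path_image (circlepath 0 \<delta>)) (G x)"
      unfolding sph G_def using \<delta> by (intro continuous_intros) auto
  qed
  have "\<exists>y\<in>C. h y \<noteq> g y"
  proof (rule no)
    have hc: "continuous_map (subtopology T D1) euclidean h"
    proof (rule continuous_map_lcI[OF oD1])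
      fix x0 and e :: real assume x0: "x0 \<in> D1" and e: "e > 0"
      obtain q2 where q2: "CS q2" "\<And>u z. u \<in> sphere 0 \<delta> \<Longrightarrow> q2 (z - (\<gamma> u + (x0 - y))) < 1 \<Longrightarrow>
          z \<in> D \<and> dist (g z) (g (\<gamma> u + (x0 - y))) < e/2"
        by (rule tube[of "sphere 0 \<delta>" "\<lambda>u. \<gamma> u + (x0 - y)" D g "e/2"])
           (use lcc_add[OF cs lcc_const] inD x0 gc oD e in auto)
      have "dist (h x) (h x0) < e" if x: "x \<in> D1" "q2 (x - x0) < 1" for x
      proof -
        \<comment> \<open>The division by \<open>cmod u = \<delta>\<close> is cancelled by the
          length \<open>2 * pi * \<delta>\<close> of the circle; after the factor
          \<open>2 * pi\<close> the bound is \<open>e/2\<close>.\<close>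
        have "cmod (contour_integral (circlepath 0 \<delta>) (G x) - contour_integral (circlepath 0 \<delta>) (G x0))
            \<le> (e/2) / \<delta> * (2 * pi * \<delta>)"
        proof (rule has_contour_integral_bound_circlepath)
          show "((\<lambda>u. G x u - G x0 u) has_contour_integral
              contour_integral (circlepath 0 \<delta>) (G x) - contour_integral (circlepath 0 \<delta>) (G x0)) (circlepath 0 \<delta>)"
            by (intro has_contour_integral_diff has_contour_integral_integral Gint x x0)
          fix u assume u: "cmod (u - 0) = \<delta>"
          have "dist (g (\<gamma> u + (x - y))) (g (\<gamma> u + (x0 - y))) < e/2"
            using q2(2)[of u "\<gamma> u + (x - y)"] x u by (simp add: algebra_simps)
          then show "cmod (G x u - G x0 u) \<le> (e/2) / \<delta>"
            using u \<delta> by (simp add: G_def diff_divide_distrib[symmetric] norm_divide dist_norm field_simps)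
        qed (use e \<delta> in auto)
        moreover
        have "h x - h x0 = (contour_integral (circlepath 0 \<delta>) (G x)
            - contour_integral (circlepath 0 \<delta>) (G x0)) / (2 * of_real pi * \<i>)"
          by (simp add: h_def diff_divide_distrib)
        then have "cmod (h x - h x0) = cmod (contour_integral (circlepath 0 \<delta>) (G x)
            - contour_integral (circlepath 0 \<delta>) (G x0)) / (2 * pi)"
          by (simp add: norm_divide norm_mult)
        ultimately have "cmod (h x - h x0) \<le> ((e/2) / \<delta> * (2 * pi * \<delta>)) / (2 * pi)"
          by (simp add: divide_right_mono)
        then have "cmod (h x - h x0) \<le> e/2" using \<delta> by simp
        then show ?thesis using e by (simp add: dist_norm)
      qed
      then show "\<exists>q. CS q \<and> (\<forall>z\<in>D1. q (z - x0) < 1 \<longrightarrow> dist (h z) (h x0) < e)"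
        using q2(1) by blast
    qed
    moreover have "\<exists>r>0. (\<forall>z\<in>ball 0 r. a + sc z v \<in> D1) \<and> (\<lambda>z. h (a + sc z v)) holomorphic_on ball 0 r"
      if a: "a \<in> D1" for a v
    proof -
      define W where "W = {z. a + sc z v \<in> D1}"
      have W: "open W" "0 \<in> W" unfolding W_def using lcc_open_vimage[OF lcc_line oD1] a by auto
      obtain r where r: "r > 0" "ball 0 r \<subseteq> W" using W open_contains_ball by metis
      have "(\<lambda>z. contour_integral (circlepath 0 \<delta>) (G (a + sc z v))) holomorphic_on W"
      proof (rule contour_integral_param_holomorphic[OF W(1)])
        have cfst: "lcc (W \<times> sphere 0 \<delta>) (\<lambda>w. \<gamma> (snd w) + ((a + sc (fst w) v) + (- y)))"
          by (intro lcc_add lcc_scale lcc_const lcc_compose[OF cs] continuous_intros) auto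
        have "continuous_on (W \<times> sphere 0 \<delta>) (\<lambda>w. g (\<gamma> (snd w) + ((a + sc (fst w) v) + (- y))))"
          by (rule lcc_cGhol[OF cfst g]) (use inD in \<open>auto simp: W_def\<close>)
        then have "continuous_on (W \<times> sphere 0 \<delta>) (\<lambda>w. g (\<gamma> (snd w) + ((a + sc (fst w) v) + (- y))) / snd w)"
          using \<delta> by (intro continuous_intros) auto
        then show "continuous_on (W \<times> path_image (circlepath 0 \<delta>)) (\<lambda>(z, u). G (a + sc z v) u)"
          unfolding sph G_def by (simp add: case_prod_unfold)
        show "(\<lambda>z. G (a + sc z v) u) holomorphic_on W" if u: "u \<in> path_image (circlepath 0 \<delta>)" for u
        proof -
          have u': "u \<in> sphere 0 \<delta>" using u unfolding sph .
          have eq: "\<gamma> u + (a + sc z v - y) = (\<gamma> u + (a - y)) + sc z v" for z by (simp add: algebra_simps)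
          have "W \<subseteq> {z. (\<gamma> u + (a - y)) + sc z v \<in> D}"
            using inD[OF _ u'] unfolding W_def eq[symmetric] by blast
          then have "(\<lambda>z. g ((\<gamma> u + (a - y)) + sc z v)) holomorphic_on W"
            using cGhol_line(2)[OF oD g] holomorphic_on_subset by blast
          then show ?thesis
            unfolding G_def eq using u' \<delta> by (intro holomorphic_intros) auto
        qed
        \<comment> \<open>Continuity of the integral in z is read off from the continuity of
          \<open>h\<close> already proved, up to the factor 2 pi i.\<close>
        have "continuous_map (top_of_set W) (subtopology T D1) (\<lambda>z. a + sc z v)"
          using lcc_line[of W a v] by (auto simp: continuous_map_in_subtopology W_def)
        then have "continuous_map (top_of_set W) euclidean (h \<circ> (\<lambda>z. a + sc z v))"
          by (rule continuous_map_compose[OF _ hc])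
        then have "continuous_on W (\<lambda>z. h (a + sc z v) * (2 * of_real pi * \<i>))"
          by (intro continuous_intros) (simp add: o_def)
        then show "continuous_on W (\<lambda>z. contour_integral (circlepath 0 \<delta>) (G (a + sc z v)))"
          by (simp add: h_def)
      qed
      then have "(\<lambda>z. h (a + sc z v)) holomorphic_on ball 0 r"
        unfolding h_def using r(2) by (intro holomorphic_intros) (auto intro: holomorphic_on_subset)
      then show ?thesis using r by (intro exI[of _ r]) (auto simp: W_def)
    qed
    ultimately show "cGhol sc P D1 h" unfolding cGhol_def by blast
  qed
  moreover have "h x = g x" if x: "x \<in> C" for x
  proof -
    have inD': "\<gamma> u + (x - y) \<in> D" if "u \<in> cball 0 \<delta>" for u
      using q1(2)[OF that, of "\<gamma> u + (x - y)"] x by (simp add: C_def)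
    have "((\<lambda>u. g (\<gamma> u + (x - y)) / (u - 0)) has_contour_integral
        (2 * of_real pi * \<i> * g (\<gamma> 0 + (x - y)))) (circlepath 0 \<delta>)"
    proof (rule Cauchy_integral_circlepath)
      show "continuous_on (cball 0 \<delta>) (\<lambda>u. g (\<gamma> u + (x - y)))"
        by (rule lcc_cGhol[OF lcc_add[OF cont lcc_const] g]) (use inD' in auto)
      \<comment> \<open>Here g is composed with a translated curve, which holomorphy along lines
        alone does not cover.\<close>
      show "(\<lambda>u. g (\<gamma> u + (x - y))) holomorphic_on ball 0 \<delta>"
      proof (rule cGhol_compose[OF open_ball _ _ oD g])
        show "lcc (ball 0 \<delta>) (\<lambda>u. \<gamma> u + (x - y))"
          by (intro lcc_add lcc_const lcc_subset[OF cont]) auto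
        show "(\<lambda>z. \<phi> (\<gamma> z + (x - y))) holomorphic_on ball 0 \<delta>" if "\<phi> \<in> dual_space sc P" for \<phi>
          unfolding dual_add[OF that] by (intro holomorphic_intros hol that)
      qed (use inD' in auto)
    qed (use \<delta> in simp)
    then show ?thesis by (simp add: h_def G_def y_def contour_integral_unique)
  qed
  ultimately show False by blast
qed

end

section \<open>Convex hulls in finite dimension\<close>

text \<open>Gaussian elimination: a non-zero coefficient of the new equation serves as pivot, its
  unknown is eliminated from the remaining equations, and back substitution restores it. Such
  solutions are the affine dependences consumed by Caratheodory's theorem.\<close>

lemma real_homogeneous_system:
  fixes A :: "'j \<Rightarrow> 'i \<Rightarrow> real"
  assumes "finite J" "finite I" "card J < card I"
  shows "\<exists>c. (\<exists>i\<in>I. c i \<noteq> 0) \<and> (\<forall>j\<in>J. (\<Sum>i\<in>I. A j i * c i) = 0)"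
  using assms
proof (induction J arbitrary: I A rule: finite_induct)
  case empty
  then show ?case by (intro exI[of _ "\<lambda>_. 1"]) (auto simp: card_gt_0_iff)
next
  case (insert j J)
  show ?case
  proof (cases "\<forall>i\<in>I. A j i = 0")
    case True
    have "card J < card I" using insert by simp
    then obtain c where "(\<exists>i\<in>I. c i \<noteq> 0)" "\<forall>j\<in>J. (\<Sum>i\<in>I. A j i * c i) = 0"
      using insert.IH insert.prems by blast
    then show ?thesis using True by (intro exI[of _ c]) auto
  next
    case False
    then obtain i0 where i0: "i0 \<in> I" "A j i0 \<noteq> 0" by blast
    define I' where "I' = I - {i0}"
    have I': "finite I'" "card J < card I'" "I = insert i0 I'" "i0 \<notin> I'"
      using insert i0 by (auto simp: I'_def)
    define A' where "A' = (\<lambda>k i. A k i - A k i0 * A j i / A j i0)"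
    obtain c where c: "\<exists>i\<in>I'. c i \<noteq> 0" "\<forall>k\<in>J. (\<Sum>i\<in>I'. A' k i * c i) = 0"
      using insert.IH[OF I'(1,2), of A'] by blast
    define s where "s = (\<Sum>i\<in>I'. A j i * c i)"
    \<comment> \<open>Back substitution: this value of the pivot unknown solves equation j.\<close>
    define c' where "c' = c(i0 := - s / A j i0)"
    have sum_I': "(\<Sum>i\<in>I'. A k i * c' i) = (\<Sum>i\<in>I'. A k i * c i)" for k
      by (rule sum.cong) (use I'(4) in \<open>auto simp: c'_def\<close>)
    have e1: "(\<Sum>i\<in>I. A k i * c' i) = (\<Sum>i\<in>I'. A k i * c i) - A k i0 * s / A j i0" for k
      using I' by (simp add: sum_I') (simp add: c'_def)
    have e2: "(\<Sum>i\<in>I'. A k i * c i) - A k i0 * s / A j i0 = (\<Sum>i\<in>I'. A' k i * c i)" for k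
      by (simp add: A'_def s_def left_diff_distrib sum_subtractf sum_distrib_left sum_divide_distrib mult.assoc)
    have e3: "(\<Sum>i\<in>I'. A j i * c i) - A j i0 * s / A j i0 = 0"
      using i0 by (simp add: s_def)
    have "\<forall>k\<in>insert j J. (\<Sum>i\<in>I. A k i * c' i) = 0"
      using c(2) e1 e2 trans[OF e1[of j] e3] by simp
    moreover have "\<exists>i\<in>I. c' i \<noteq> 0" using c(1) I' by (auto simp: c'_def)
    ultimately show ?thesis by blast
  qed
qed

context complex_space
begin

lemma cconv_hullI:
  assumes I: "finite I" and "\<And>i. i \<in> I \<Longrightarrow> 0 \<le> t i" "\<And>i. i \<in> I \<Longrightarrow> b i \<in> B" "(\<Sum>i\<in>I. t i) = 1"
  shows "(\<Sum>i\<in>I. sc (of_real (t i)) (b i)) \<in> cconv_hull sc B"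
proof -
  obtain h where h: "bij_betw h {..<card I} I"
    using ex_bij_betw_nat_finite[OF I] by (auto simp: atLeast0LessThan)
  have "(\<Sum>i\<in>I. sc (of_real (t i)) (b i)) = (\<Sum>i<card I. sc (of_real (t (h i))) (b (h i)))"
    using sum.reindex_bij_betw[OF h, of "\<lambda>i. sc (of_real (t i)) (b i)"] by simp
  moreover have "(\<Sum>i<card I. t (h i)) = 1"
    using sum.reindex_bij_betw[OF h, of t] assms by simp
  moreover have "\<forall>i<card I. 0 \<le> t (h i) \<and> b (h i) \<in> B"
    using h assms by (auto dest: bij_betwE)
  ultimately show ?thesis
    unfolding cconv_hull_def mem_Collect_eq
    by (intro exI[of _ "card I"] exI[of _ "\<lambda>i. t (h i)"] exI[of _ "\<lambda>i. b (h i)"] conjI)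
qed

lemma cconv_hull_subset: "B \<subseteq> cconv_hull sc B"
proof
  fix b assume "b \<in> B"
  then show "b \<in> cconv_hull sc B"
    using cconv_hullI[of "{()}" "\<lambda>_. 1" "\<lambda>_. b" B] by simp
qed

lemma cconv_hull_mono: "B \<subseteq> B' \<Longrightarrow> cconv_hull sc B \<subseteq> cconv_hull sc B'"
  unfolding cconv_hull_def by blast

lemma cconv_hull_convex:
  assumes k: "k \<in> cconv_hull sc B" and l: "l \<in> cconv_hull sc B"
    and st: "0 \<le> s" "0 \<le> r" "s + r = 1"
  shows "sc (of_real s) k + sc (of_real r) l \<in> cconv_hull sc B"
proof -
  obtain n :: nat and t1 b1 where 1: "\<forall>i<n. 0 \<le> t1 i \<and> b1 i \<in> B" "(\<Sum>i<n. t1 i) = 1"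
    "k = (\<Sum>i<n. sc (of_real (t1 i)) (b1 i))"
    using k unfolding cconv_hull_def by blast
  obtain m :: nat and t2 b2 where 2: "\<forall>i<m. 0 \<le> t2 i \<and> b2 i \<in> B" "(\<Sum>i<m. t2 i) = 1"
    "l = (\<Sum>i<m. sc (of_real (t2 i)) (b2 i))"
    using l unfolding cconv_hull_def by blast
  define I where "I = {..<n} <+> {..<m}"
  define t where "t = case_sum (\<lambda>i. s * t1 i) (\<lambda>i. r * t2 i)"
  define b where "b = case_sum b1 b2"
  have "(\<Sum>i\<in>I. sc (of_real (t i)) (b i)) \<in> cconv_hull sc B"
  proof (rule cconv_hullI)
    show "(\<Sum>i\<in>I. t i) = 1"
      using 1 2 st by (simp add: I_def t_def sum.Plus sum_distrib_left[symmetric])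
  qed (use 1 2 st in \<open>auto simp: I_def t_def b_def\<close>)
  moreover have "(\<Sum>i\<in>I. sc (of_real (t i)) (b i)) = sc (of_real s) k + sc (of_real r) l"
    by (simp add: I_def t_def b_def sum.Plus 1(3) 2(3) scale_sum_right)
  ultimately show ?thesis by simp
qed

text \<open>Y has real dimension at most \<open>2 * card S\<close>, and one more term accounts for
  the affine constraint. The combination has exactly \<open>N\<close> terms, padded with zero
  weights, so that one fixed parameter space covers the whole hull.\<close>

lemma caratheodory:
  assumes S: "finite S" "span S = UNIV" and y: "y \<in> cconv_hull sc B"
  defines "N \<equiv> 2 * card S + 1"
  obtains t b where "\<forall>i. 0 \<le> t i" "\<forall>i. b i \<in> B" "(\<Sum>i<N. t i) = (1::real)"
    "y = (\<Sum>i<N. sc (of_real (t i)) (b i))"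
proof -
  define rep where "rep = (\<lambda>(I :: nat set) t b. (\<forall>i\<in>I. 0 \<le> t i \<and> b i \<in> B) \<and> (\<Sum>i\<in>I. t i) = (1::real) \<and>
    y = (\<Sum>i\<in>I. sc (of_real (t i)) (b i)))"
  have reduce: "\<exists>i\<in>I. \<exists>t' b'. rep (I - {i}) t' b'" if I: "finite I" "card I > N" "rep I t b" for I t b
  proof -
    have "\<forall>i. \<exists>r. b i = (\<Sum>s\<in>S. sc (r s) s)"
      using S(2) span_finite[OF S(1)] by (auto simp: image_iff)
    then obtain r where r: "\<And>i. b i = (\<Sum>s\<in>S. sc (r i s) s)" by metis
    \<comment> \<open>The equations of the system: \<open>None\<close> says that the coefficients
      sum to 0, and each \<open>s\<close> contributes a real and an imaginary part.\<close>
    define J where "J = insert None (Some ` (S \<times> (UNIV :: bool set)))"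
    have J: "finite J" "card J = N"
      using S(1) by (auto simp: J_def card_insert_if card_image card_cartesian_product N_def)
    define A where "A = (\<lambda>j i. case j of None \<Rightarrow> 1 | Some (s, u) \<Rightarrow> if u then Re (r i s) else Im (r i s))"
    obtain c where c: "\<exists>i\<in>I. c i \<noteq> 0" "\<forall>j\<in>J. (\<Sum>i\<in>I. A j i * c i) = 0"
      using real_homogeneous_system[OF J(1) I(1), of A] I(2) J(2) by auto
    have c_sum: "(\<Sum>i\<in>I. c i) = 0" using c(2) by (auto simp: J_def A_def)
    have "(\<Sum>i\<in>I. of_real (c i) * r i s) = 0" if s: "s \<in> S" for s
    proof (rule complex_eqI)
      show "Re (\<Sum>i\<in>I. of_real (c i) * r i s) = Re 0"
        using c(2)[rule_format, of "Some (s, True)"] s by (simp add: J_def A_def mult.commute)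
      show "Im (\<Sum>i\<in>I. of_real (c i) * r i s) = Im 0"
        using c(2)[rule_format, of "Some (s, False)"] s by (simp add: J_def A_def mult.commute)
    qed
    then have "(\<Sum>s\<in>S. sc (\<Sum>i\<in>I. of_real (c i) * r i s) s) = 0" by simp
    moreover have "(\<Sum>i\<in>I. sc (of_real (c i)) (b i)) = (\<Sum>s\<in>S. sc (\<Sum>i\<in>I. of_real (c i) * r i s) s)"
      unfolding r scale_sum_right scale_scale scale_sum_left by (rule sum.swap)
    ultimately have c_vec: "(\<Sum>i\<in>I. sc (of_real (c i)) (b i)) = 0" by simp
    have "\<exists>i\<in>I. c i > 0"
    proof (rule ccontr)
      assume "\<not> ?thesis"
      then have "\<forall>i\<in>I. - c i \<ge> 0" by force
      then have "\<forall>i\<in>I. - c i = 0"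
        using sum_nonneg_eq_0_iff[OF I(1), of "\<lambda>i. - c i"] c_sum by (simp add: sum_negf)
      then show False using c(1) by auto
    qed
    then have "finite {i\<in>I. c i > 0}" "{i\<in>I. c i > 0} \<noteq> {}" using I by auto
    then obtain k where k: "k \<in> I" "c k > 0" and kmin: "\<And>i. i \<in> I \<Longrightarrow> c i > 0 \<Longrightarrow> t k / c k \<le> t i / c i"
      using arg_min_if_finite(1)[of "{i\<in>I. c i > 0}" "\<lambda>i. t i / c i"]
        arg_min_least[of "{i\<in>I. c i > 0}" _ "\<lambda>i. t i / c i"] by fastforce
    \<comment> \<open>The longest step against c that keeps all weights non-negative; the weight at
      \<open>k\<close> reaches 0.\<close>
    define \<tau> where "\<tau> = t k / c k"
    have tau: "\<tau> \<ge> 0" using k I(3) by (auto simp: \<tau>_def rep_def)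
    define t' where "t' = (\<lambda>i. t i - \<tau> * c i)"
    have t'k: "t' k = 0" using k by (simp add: t'_def \<tau>_def)
    have t'0: "0 \<le> t' i" if "i \<in> I" for i
    proof (cases "c i > 0")
      case True
      then show ?thesis using kmin[OF that True] by (simp add: t'_def \<tau>_def field_simps)
    next
      case False
      then have "\<tau> * c i \<le> 0" using tau by (simp add: mult_nonneg_nonpos)
      moreover have "0 \<le> t i" using I(3) that by (auto simp: rep_def)
      ultimately show ?thesis by (simp add: t'_def)
    qed
    have "(\<Sum>i\<in>I. t' i) = 1"
      using I(3) c_sum by (simp add: t'_def sum_subtractf sum_distrib_left[symmetric] rep_def)
    then have 1: "(\<Sum>i\<in>I - {k}. t' i) = 1" using k(1) I(1) t'k by (simp add: sum.remove)
    have "(\<Sum>i\<in>I. sc (of_real (t' i)) (b i))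
        = (\<Sum>i\<in>I. sc (of_real (t i)) (b i)) - sc (of_real \<tau>) (\<Sum>i\<in>I. sc (of_real (c i)) (b i))"
      by (simp add: t'_def scale_left_diff_distrib sum_subtractf scale_sum_right)
    then have "(\<Sum>i\<in>I. sc (of_real (t' i)) (b i)) = y" using c_vec I(3) by (simp add: rep_def)
    then have 2: "(\<Sum>i\<in>I - {k}. sc (of_real (t' i)) (b i)) = y"
      using k(1) I(1) t'k by (simp add: sum.remove)
    have "rep (I - {k}) t' b" using 1 2 t'0 I(3) by (auto simp: rep_def)
    then show ?thesis using k(1) by blast
  qed
  have small: "\<exists>I t b. finite I \<and> card I \<le> N \<and> rep I t b" if "finite I" "rep I t b" for I t b
    using that
  proof (induction "card I" arbitrary: I t b rule: less_induct)
    case less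
    show ?case
    proof (cases "card I \<le> N")
      case True then show ?thesis using less.prems by blast
    next
      case False
      then obtain i t' b' where i: "i \<in> I" "rep (I - {i}) t' b'"
        using reduce[OF less.prems(1) _ less.prems(2)] by auto
      show ?thesis
        using less.hyps[OF card_Diff1_less[OF less.prems(1) i(1)] finite_Diff[OF less.prems(1)] i(2)] .
    qed
  qed
  obtain n :: nat and t0 b0 where "\<forall>i<n. 0 \<le> t0 i \<and> b0 i \<in> B" "(\<Sum>i<n. t0 i) = (1::real)"
    "y = (\<Sum>i<n. sc (of_real (t0 i)) (b0 i))"
    using y unfolding cconv_hull_def by blast
  then have "rep {..<n} t0 b0" by (simp add: rep_def)
  then obtain I t b where I: "finite I" "card I \<le> N" "rep I t b" using small by blast
  have "I \<noteq> {}" using I(3) by (auto simp: rep_def)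
  then obtain j where j: "j \<in> I" by blast
  obtain h where h: "bij_betw h {..<card I} I"
    using ex_bij_betw_nat_finite[OF I(1)] by (auto simp: atLeast0LessThan)
  define t' where "t' = (\<lambda>i. if i < card I then t (h i) else 0)"
  \<comment> \<open>Padding terms carry weight 0 but must still be points of \<open>B\<close>, hence
    the fixed index \<open>j\<close>.\<close>
  define b' where "b' = (\<lambda>i. if i < card I then b (h i) else b j)"
  have hI: "h i \<in> I" if "i < card I" for i using h that by (auto dest: bij_betwE)
  have sub: "{..<card I} \<subseteq> {..<N}" using I(2) by auto
  show ?thesis
  proof (rule that[of t' b'])
    show "\<forall>i. 0 \<le> t' i" using I(3) hI by (auto simp: t'_def rep_def)
    show "\<forall>i. b' i \<in> B" using I(3) hI j by (auto simp: b'_def rep_def)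
    have "(\<Sum>i<N. t' i) = (\<Sum>i<card I. t' i)"
      by (rule sum.mono_neutral_right[OF _ sub]) (auto simp: t'_def)
    also have "\<dots> = (\<Sum>i<card I. t (h i))" by (simp add: t'_def)
    also have "\<dots> = 1" using sum.reindex_bij_betw[OF h, of t] I(3) by (simp add: rep_def)
    finally show "(\<Sum>i<N. t' i) = 1" .
    have "(\<Sum>i<N. sc (of_real (t' i)) (b' i)) = (\<Sum>i<card I. sc (of_real (t' i)) (b' i))"
      by (rule sum.mono_neutral_right[OF _ sub]) (auto simp: t'_def)
    also have "\<dots> = (\<Sum>i<card I. sc (of_real (t (h i))) (b (h i)))" by (simp add: t'_def b'_def)
    also have "\<dots> = y"
      using sum.reindex_bij_betw[OF h, of "\<lambda>i. sc (of_real (t i)) (b i)"] I(3) by (simp add: rep_def)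
    finally show "y = (\<Sum>i<N. sc (of_real (t' i)) (b' i))" by simp
  qed
qed

end

context sc_lc_space
begin

text \<open>By Caratheodory the hull is the image of one compact parameter set under a continuous
  map, hence compact, hence closed in the Hausdorff space Y.\<close>

lemma closed_cconv_hull_compact_image:
  fixes F :: "'c::metric_space \<Rightarrow> 'a"
  assumes fd: "fin_dim sc" and K: "compact K" and F: "lcc K F"
  shows "T closure_of (cconv_hull sc (F ` K)) = cconv_hull sc (F ` K)"
proof -
  obtain S where S: "finite S" "span S = UNIV" using fd unfolding fin_dim_def by blast
  define N where "N = 2 * card S + 1"
  \<comment> \<open>Parameters are sequences of pairs (weight, point), so Tychonoff applies to the
    full product; the sum constraint reads only the first \<open>N\<close> weights.\<close>
  define X :: "(nat \<Rightarrow> real \<times> 'c) set"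
    where "X = (PiE UNIV (\<lambda>_. {0..1} \<times> K)) \<inter> {g. (\<Sum>i<N. fst (g i)) = 1}"
  have coord: "continuous_on A (\<lambda>g. g i)" for A :: "(nat \<Rightarrow> real \<times> 'c) set" and i
    by (rule continuous_on_subset[OF continuous_on_product_coordinates subset_UNIV])
  have "compact (PiE UNIV (\<lambda>_. {0..1} \<times> K) :: (nat \<Rightarrow> real \<times> 'c) set)"
    using compactin_PiE[of "\<lambda>_. euclidean :: (real \<times> 'c) topology" UNIV "\<lambda>_::nat. {0..1} \<times> K"]
      K compact_Times[of "{0..1::real}" K] by (simp add: euclidean_product_topology)
  moreover have "closed {g :: nat \<Rightarrow> real \<times> 'c. (\<Sum>i<N. fst (g i)) = 1}"
    by (intro closed_Collect_eq continuous_intros coord)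
  ultimately have X: "compact X" unfolding X_def by (rule compact_Int_closed)
  have XK: "0 \<le> fst (g i)" "snd (g i) \<in> K" if "g \<in> X" for g i
  proof -
    have "g i \<in> {0..1} \<times> K" using that by (auto simp: X_def)
    then show "0 \<le> fst (g i)" "snd (g i) \<in> K" by (auto simp: mem_Times_iff)
  qed
  have im: "cconv_hull sc (F ` K) = (\<lambda>g. \<Sum>i<N. sc (of_real (fst (g i))) (F (snd (g i)))) ` X"
  proof (intro equalityI subsetI)
    fix y assume "y \<in> cconv_hull sc (F ` K)"
    from caratheodory[OF S this]
    obtain t b where tb: "\<forall>i. 0 \<le> t i" "\<forall>i. b i \<in> F ` K" "(\<Sum>i<N. t i) = (1::real)"
      "y = (\<Sum>i<N. sc (of_real (t i)) (b i))"
      unfolding N_def by blast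
    have "\<forall>i. \<exists>x. x \<in> K \<and> b i = F x" using tb(2) by blast
    then obtain k where k: "\<And>i. k i \<in> K" "\<And>i. b i = F (k i)" by metis
    obtain k0 where k0: "k0 \<in> K" using k(1) by blast
    \<comment> \<open>Weights from index \<open>N\<close> on are set to 0, since the bound by 1 is
      derived only for the terms of the sum.\<close>
    define g where "g = (\<lambda>i. (if i < N then t i else 0, k i))"
    have "t i \<le> 1" if "i < N" for i
      using member_le_sum[of i "{..<N}" t] that tb by simp
    then have "g \<in> X" using tb k by (auto simp: X_def g_def)
    moreover have "y = (\<Sum>i<N. sc (of_real (fst (g i))) (F (snd (g i))))"
      using tb(4) k(2) by (simp add: g_def)
    ultimately show "y \<in> (\<lambda>g. \<Sum>i<N. sc (of_real (fst (g i))) (F (snd (g i)))) ` X" by blast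
  next
    fix y assume "y \<in> (\<lambda>g. \<Sum>i<N. sc (of_real (fst (g i))) (F (snd (g i)))) ` X"
    then obtain g where g: "g \<in> X" "y = (\<Sum>i<N. sc (of_real (fst (g i))) (F (snd (g i))))" by blast
    then show "y \<in> cconv_hull sc (F ` K)"
      unfolding g(2) using XK[OF g(1)] by (intro cconv_hullI) (auto simp: X_def)
  qed
  have "lcc X (\<lambda>g. \<Sum>i<N. sc (of_real (fst (g i))) (F (snd (g i))))"
    by (intro lcc_sum lcc_scale lcc_compose[OF F] continuous_intros coord)
       (use XK in auto)
  moreover have "compactin (top_of_set X) X"
    using X by (simp add: compactin_subtopology)
  ultimately have "compactin T (cconv_hull sc (F ` K))"
    unfolding im by (intro image_compactin)
  then show ?thesis
    using compactin_imp_closedin[OF haus] by (simp add: closure_of_closedin)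
qed

end

section \<open>Bounded open subsets of a complex plane\<close>

text \<open>A complex line in the coordinates of one plane; \<open>par2_cline\<close> carries it to
  an affine line of X.\<close>

definition cline :: "complex \<times> complex \<Rightarrow> complex \<times> complex \<Rightarrow> complex \<Rightarrow> complex \<times> complex" where
  "cline w v z = (fst w + z * fst v, snd w + z * snd v)"

lemma cline_0 [simp]: "cline w v 0 = w"
  by (simp add: cline_def)

lemma cline_add: "cline (cline w v s) v z = cline w v (s + z)"
  by (simp add: cline_def algebra_simps)

lemma continuous_on_cline [continuous_intros]:
  "continuous_on S f \<Longrightarrow> continuous_on S h \<Longrightarrow> continuous_on S (\<lambda>x. cline (f x) v (h x))"
  unfolding cline_def by (intro continuous_intros)

lemma bounded_cline_vimage:
  assumes "bounded U" "v \<noteq> 0" shows "bounded {z. cline w v z \<in> U}"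
proof -
  obtain B where B: "\<And>p. p \<in> U \<Longrightarrow> norm p \<le> B" using assms(1) bounded_iff by metis
  have "norm z \<le> (B + norm w) / norm v" if "cline w v z \<in> U" for z
  proof -
    have "cline w v z - w = (z * fst v, z * snd v)" by (simp add: cline_def prod_eq_iff)
    then have "norm (cline w v z - w) = norm z * norm v"
      by (simp add: norm_prod_def norm_mult power_mult_distrib distrib_left[symmetric] real_sqrt_mult)
    moreover have "norm (cline w v z - w) \<le> B + norm w"
      using norm_triangle_ineq4[of "cline w v z" w] B[OF that] by simp
    ultimately show ?thesis using assms(2) by (simp add: field_simps)
  qed
  then show ?thesis unfolding bounded_iff by blast
qed

text \<open>Take a point of E farthest from some a outside E and let u point away from a and w along
the complex tangent: then \<open>|z + su + \<zeta>w - a|\<^sup>2 = ((1 + s)\<^sup>2 + |\<zeta>|\<^sup>2) |z - a|\<^sup>2\<close>.\<close>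

lemma extremal_point:
  fixes E :: "(complex \<times> complex) set"
  assumes E: "compact E" "E \<noteq> {}"
  obtains z u w where "z \<in> E"
    "\<forall>s \<zeta>. 0 \<le> s \<longrightarrow> s \<noteq> 0 \<or> \<zeta> \<noteq> 0 \<longrightarrow> cline (cline z u (of_real s)) w \<zeta> \<notin> E"
proof -
  have "E \<noteq> UNIV" using E(1) compact_imp_bounded not_bounded_UNIV by metis
  \<comment> \<open>Since a lies outside \<open>E\<close>, the farthest point differs from it and
    the radial direction is non-zero.\<close>
  then obtain a where a: "a \<notin> E" by blast
  obtain z where z: "z \<in> E" "\<And>y. y \<in> E \<Longrightarrow> dist a y \<le> dist a z"
    using continuous_attains_sup[OF E continuous_on_dist[OF continuous_on_const continuous_on_id], of a] by blast
  define \<alpha> where "\<alpha> = fst z - fst a"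
  define \<beta> where "\<beta> = snd z - snd a"
  define N where "N = (cmod \<alpha>)\<^sup>2 + (cmod \<beta>)\<^sup>2"
  have "z \<noteq> a" using z(1) a by blast
  then have "\<alpha> \<noteq> 0 \<or> \<beta> \<noteq> 0" by (auto simp: \<alpha>_def \<beta>_def prod_eq_iff)
  then have N: "N > 0" by (auto simp: N_def add_pos_nonneg add_nonneg_pos)
  have "cline (cline z (\<alpha>, \<beta>) (of_real s)) (- cnj \<beta>, cnj \<alpha>) \<zeta> \<notin> E"
    if s: "0 \<le> s" "s \<noteq> 0 \<or> \<zeta> \<noteq> 0" for s \<zeta>
  proof
    assume inE: "cline (cline z (\<alpha>, \<beta>) (of_real s)) (- cnj \<beta>, cnj \<alpha>) \<zeta> \<in> E"
    have sq: "(dist a p)\<^sup>2 = (cmod (fst p - fst a))\<^sup>2 + (cmod (snd p - snd a))\<^sup>2" for p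
      by (simp add: dist_prod_def dist_norm norm_minus_commute)
    \<comment> \<open>The directions \<open>(\<alpha>, \<beta>)\<close> and
      \<open>(- cnj \<beta>, cnj \<alpha>)\<close> are Hermitian-orthogonal of equal length, so the
      mixed terms cancel.\<close>
    have "(cmod (of_real (1 + s) * \<alpha> - \<zeta> * cnj \<beta>))\<^sup>2 + (cmod (of_real (1 + s) * \<beta> + \<zeta> * cnj \<alpha>))\<^sup>2
        = ((1 + s)\<^sup>2 + (cmod \<zeta>)\<^sup>2) * N"
      unfolding N_def cmod_power2 by (simp add: power2_eq_square algebra_simps)
    moreover have "fst (cline (cline z (\<alpha>, \<beta>) (of_real s)) (- cnj \<beta>, cnj \<alpha>) \<zeta>) - fst a
        = of_real (1 + s) * \<alpha> - \<zeta> * cnj \<beta>"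
      by (simp add: cline_def \<alpha>_def algebra_simps)
    moreover have "snd (cline (cline z (\<alpha>, \<beta>) (of_real s)) (- cnj \<beta>, cnj \<alpha>) \<zeta>) - snd a
        = of_real (1 + s) * \<beta> + \<zeta> * cnj \<alpha>"
      by (simp add: cline_def \<beta>_def algebra_simps)
    ultimately have "(dist a (cline (cline z (\<alpha>, \<beta>) (of_real s)) (- cnj \<beta>, cnj \<alpha>) \<zeta>))\<^sup>2
        = ((1 + s)\<^sup>2 + (cmod \<zeta>)\<^sup>2) * N"
      unfolding sq by simp
    moreover have "(dist a z)\<^sup>2 = N" unfolding sq N_def \<alpha>_def \<beta>_def ..
    ultimately have "((1 + s)\<^sup>2 + (cmod \<zeta>)\<^sup>2) * N \<le> N"
      using z(2)[OF inE] by (metis power_mono zero_le_dist)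
    then have "(1 + s)\<^sup>2 + (cmod \<zeta>)\<^sup>2 \<le> 1" using N by simp
    moreover have "(1 + s)\<^sup>2 = 1 + 2 * s + s\<^sup>2" by (simp add: power2_eq_square algebra_simps)
    ultimately have "2 * s + s\<^sup>2 + (cmod \<zeta>)\<^sup>2 \<le> 0" by simp
    then show False using s by (smt (verit) zero_less_power2 zero_le_power2 norm_eq_zero)
  qed
  then show ?thesis using that[of z "(\<alpha>, \<beta>)" "(- cnj \<beta>, cnj \<alpha>)"] z(1) by blast
qed

text \<open>Openness of \<open>U\<close> near the extremal point keeps all short pushed discs inside
  \<open>U\<close>, including the limit disc at \<open>s = 0\<close>, whose only point in
  \<open>E\<close> is its centre.\<close>

lemma discs_approaching_compact:
  fixes E :: "(complex \<times> complex) set"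
  assumes E: "compact E" "E \<noteq> {}" and U: "open U" "E \<subseteq> U"
  obtains z u w \<delta> where "z \<in> E" "\<delta> > 0"
    "\<forall>s \<zeta>. 0 \<le> s \<longrightarrow> s \<le> \<delta> \<longrightarrow> cmod \<zeta> \<le> \<delta> \<longrightarrow> cline (cline z u (of_real s)) w \<zeta> \<in> U"
    "\<forall>s \<zeta>. 0 \<le> s \<longrightarrow> s \<noteq> 0 \<or> \<zeta> \<noteq> 0 \<longrightarrow> cline (cline z u (of_real s)) w \<zeta> \<notin> E"
proof -
  obtain z u w where z: "z \<in> E"
    "\<forall>s \<zeta>. 0 \<le> s \<longrightarrow> s \<noteq> 0 \<or> \<zeta> \<noteq> 0 \<longrightarrow> cline (cline z u (of_real s)) w \<zeta> \<notin> E"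
    by (rule extremal_point[OF E])
  let ?pt = "\<lambda>p :: real \<times> complex. cline (cline z u (of_real (fst p))) w (snd p)"
  have "continuous_on UNIV ?pt" by (intro continuous_intros)
  then have op: "open (?pt -` U)" by (rule open_vimage[OF U(1)])
  have in0: "(0, 0) \<in> ?pt -` U" using z(1) U(2) by auto
  obtain r where r: "r > 0" "ball (0, 0) r \<subseteq> ?pt -` U" using openE[OF op in0] by blast
  \<comment> \<open>A third for each component leaves the norm of the pair below r by the triangle
    inequality.\<close>
  have "cline (cline z u (of_real s)) w \<zeta> \<in> U" if "0 \<le> s" "s \<le> r/3" "cmod \<zeta> \<le> r/3" for s \<zeta>
  proof -
    have "norm (s, \<zeta>) < r" using norm_Pair_le[of s \<zeta>] that r by simp
    then have "(s, \<zeta>) \<in> ball (0, 0) r" by (simp add: dist_norm norm_minus_commute norm_prod_def)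
    then show ?thesis using r(2) by auto
  qed
  then show ?thesis using r z by (intro that[of z "r/3" u w]) simp_all
qed

context sc_lc_space
begin

section \<open>Maps on the closure of a bounded open set in a plane\<close>

context
  fixes U :: "(complex \<times> complex) set" and F :: "complex \<times> complex \<Rightarrow> 'a"
  assumes oU: "open U" and bU: "bounded U" and contF: "lcc (closure U) F"
    and holF: "\<And>w v \<phi>. w \<in> U \<Longrightarrow> \<phi> \<in> dual_space sc P \<Longrightarrow>
      \<exists>r>0. (\<lambda>z. \<phi> (F (cline w v z))) holomorphic_on ball 0 r"
begin

lemma slice_holomorphic:
  assumes \<phi>: "\<phi> \<in> dual_space sc P" and S: "\<And>z. z \<in> S \<Longrightarrow> cline w v z \<in> U"
  shows "(\<lambda>z. \<phi> (F (cline w v z))) holomorphic_on S"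
proof -
  have "(\<lambda>z. \<phi> (F (cline w v z))) field_differentiable (at s)" if s: "s \<in> S" for s
  proof -
    obtain r where r: "r > 0" "(\<lambda>z. \<phi> (F (cline (cline w v s) v z))) holomorphic_on ball 0 r"
      using holF[OF S[OF s] \<phi>] by blast
    then have "(\<lambda>z. \<phi> (F (cline w v (s + z)))) field_differentiable (at (s - s))"
      using holomorphic_on_imp_differentiable_at[OF r(2)] by (simp add: cline_add)
    then have "((\<lambda>z. \<phi> (F (cline w v (s + z)))) \<circ> (\<lambda>z. z - s)) field_differentiable (at s)"
      by (intro field_differentiable_compose) (auto intro!: derivative_intros field_differentiable_diff)
    then show ?thesis by (simp add: o_def)
  qed
  then show ?thesis
    unfolding holomorphic_on_def using field_differentiable_at_within by blast
qed

lemma closure_eq: "closure U = U \<union> frontier U"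
  using oU by (simp add: closure_Un_frontier)

lemma contF_cline:
  assumes "continuous_on S f" "continuous_on S h" "\<And>x. x \<in> S \<Longrightarrow> cline (f x) v (h x) \<in> U"
  shows "lcc S (\<lambda>x. F (cline (f x) v (h x)))"
  using lcc_compose[OF contF continuous_on_cline[OF assms(1,2)]] assms(3) closure_subset by blast

lemma in_closed_hull_frontier:
  assumes x: "x \<in> U"
  shows "F x \<in> T closure_of (cconv_hull sc (F ` frontier U))"
proof (rule ccontr)
  assume no: "\<not> ?thesis"
  \<comment> \<open>Separation needs a non-empty set: a non-empty bounded open set has a
    boundary.\<close>
  have "U \<noteq> UNIV" using bU not_bounded_UNIV by metis
  then have "frontier U \<noteq> {}" using x frontier_eq_empty by blast
  then have ne: "cconv_hull sc (F ` frontier U) \<noteq> {}" using cconv_hull_subset by blast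
  obtain \<phi> where \<phi>: "\<phi> \<in> dual_space sc P"
    "\<And>k. k \<in> cconv_hull sc (F ` frontier U) \<Longrightarrow> Re (\<phi> (F x)) + 1 \<le> Re (\<phi> k)"
    by (rule closed_convex_separation[OF no ne]) (auto intro: cconv_hull_convex)
  \<comment> \<open>Any non-zero direction would do; one slice through x suffices for the hull
    statement.\<close>
  define v where "v = (1 :: complex, 0 :: complex)"
  define S where "S = {z. cline x v z \<in> U}"
  have cl: "continuous_on A (cline x v)" for A by (intro continuous_intros)
  have oS: "open S" unfolding S_def using open_vimage[OF oU cl] by (simp add: vimage_def)
  have bS: "bounded S" unfolding S_def by (rule bounded_cline_vimage[OF bU]) (simp add: v_def zero_prod_def)
  have "closed {z. cline x v z \<in> closure U}"
    using closed_vimage[OF closed_closure cl] by (simp add: vimage_def)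
  then have clS: "closure S \<subseteq> {z. cline x v z \<in> closure U}"
    by (intro closure_minimal) (auto simp: S_def closure_subset[THEN subsetD])
  have frS: "cline x v z \<in> frontier U" if "z \<in> frontier S" for z
  proof -
    have "z \<in> closure S" "z \<notin> S" using that oS by (auto simp: frontier_def interior_open)
    then show ?thesis using clS oU by (auto simp: S_def frontier_def interior_open)
  qed
  \<comment> \<open>The sign is changed because the separation bounds \<open>Re \<phi>\<close> from
    below on the boundary values while the maximum principle needs an upper bound; the gap 1 then
    contradicts the value at x.\<close>
  have "Re (- \<phi> (F (cline x v 0))) \<le> - Re (\<phi> (F x)) - 1"
  proof (rule maximum_real_frontier[where S = S and f = "\<lambda>z. - \<phi> (F (cline x v z))"])
    show "(\<lambda>z. - \<phi> (F (cline x v z))) holomorphic_on interior S"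
      unfolding interior_open[OF oS] by (intro holomorphic_intros slice_holomorphic \<phi>) (simp add: S_def)
    have "lcc (closure S) (\<lambda>z. F (cline x v z))"
      by (rule lcc_compose[OF contF cl]) (use clS in auto)
    then show "continuous_on (closure S) (\<lambda>z. - \<phi> (F (cline x v z)))"
      by (intro continuous_intros lcc_dual \<phi>)
    show "Re (- \<phi> (F (cline x v z))) \<le> - Re (\<phi> (F x)) - 1" if "z \<in> frontier S" for z
      using \<phi>(2)[OF subsetD[OF cconv_hull_subset imageI[OF frS[OF that]]]] by simp
  qed (use bS x in \<open>auto simp: S_def\<close>)
  then show False by simp
qed

lemma image_subset_domain_of_holomorphy:
  assumes D: "domain_of_holomorphy sc P D" and fr: "F ` frontier U \<subseteq> D" and x: "x \<in> U"
  shows "F x \<in> D"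
proof (rule ccontr)
  assume xD: "F x \<notin> D"
  have oD: "openin T D" using D by (simp add: domain_of_holomorphy_def)
  \<comment> \<open>Taken in the closure so that compactness is immediate; the boundary hypothesis
    then places \<open>E\<close> inside \<open>U\<close>.\<close>
  define E where "E = closure U - {w \<in> closure U. F w \<in> D}"
  have "openin (top_of_set (closure U)) {w \<in> closure U. F w \<in> D}"
    using openin_continuous_map_preimage[OF contF oD] by simp
  then have "closedin (top_of_set (closure U)) E" unfolding E_def by (simp add: closedin_def Diff_Diff_Int Int_absorb1)
  then have cE: "compact E"
    using bU bounded_closure compact_eq_bounded_closed closedin_compact by (metis closed_closure)
  have EU: "E \<subseteq> U" using fr closure_eq by (auto simp: E_def)
  have Ene: "E \<noteq> {}" using x xD closure_subset by (auto simp: E_def)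
  obtain z u w \<delta> where z: "z \<in> E" "\<delta> > 0"
    and inU_all: "\<forall>s \<zeta>. 0 \<le> s \<longrightarrow> s \<le> \<delta> \<longrightarrow> cmod \<zeta> \<le> \<delta> \<longrightarrow> cline (cline z u (of_real s)) w \<zeta> \<in> U"
    and notE_all: "\<forall>s \<zeta>. 0 \<le> s \<longrightarrow> s \<noteq> 0 \<or> \<zeta> \<noteq> 0 \<longrightarrow> cline (cline z u (of_real s)) w \<zeta> \<notin> E"
    by (rule discs_approaching_compact[OF cE Ene oU EU])
  note inU = inU_all[rule_format] and notE = notE_all[rule_format]
  have inD: "F (cline (cline z u (of_real s)) w \<zeta>) \<in> D"
    if "0 \<le> s" "s \<le> \<delta>" "cmod \<zeta> \<le> \<delta>" "s \<noteq> 0 \<or> \<zeta> \<noteq> 0" for s \<zeta>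
    using inU[OF that(1-3)] notE[OF that(1,4)] closure_subset by (auto simp: E_def)
  \<comment> \<open>All boundary circles at once, the one at \<open>s = 0\<close> included: the tube
    seminorm q is then fixed before s is chosen.\<close>
  define K where "K = {0..\<delta>} \<times> sphere (0::complex) \<delta>"
  define \<kappa> where "\<kappa> = (\<lambda>p :: real \<times> complex. F (cline (cline z u (of_real (fst p))) w (snd p)))"
  obtain q where q: "CS q" "\<And>p y. p \<in> K \<Longrightarrow> q (y - \<kappa> p) < 1 \<Longrightarrow> y \<in> D"
  proof (rule tube_open[of K \<kappa> D])
    show "compact K" unfolding K_def by (intro compact_Times) auto
    show "lcc K \<kappa>" unfolding \<kappa>_def
      by (intro contF_cline continuous_intros) (use inU in \<open>auto simp: K_def\<close>)
    show "\<kappa> ` K \<subseteq> D" using inD z(2) by (auto simp: K_def \<kappa>_def)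
  qed (use oD in auto)
  have "lcc {0..\<delta>} (\<lambda>s. F (cline z u (of_real s)))"
    by (intro contF_cline continuous_intros) (use inU[of _ 0] z(2) in auto)
  from lccD[OF this, of 0 q 1] obtain d where d: "d > 0"
    "\<And>s. s \<in> {0..\<delta>} \<Longrightarrow> dist s 0 < d \<Longrightarrow> q (F (cline z u (of_real s)) - F (cline z u (of_real 0))) < 1"
    using q(1) z(2) by auto
  \<comment> \<open>Now s is small enough for \<open>F z\<close> to lie in the q-ball about the
    centre value, while the disc at height s avoids \<open>E\<close> because
    \<open>s > 0\<close>.\<close>
  define s where "s = min (d/2) \<delta>"
  have s: "0 < s" "s \<le> \<delta>" "s < d" using d(1) z(2) by (auto simp: s_def)
  have close: "q (F z - F (cline z u (of_real s))) < 1"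
    using d(2)[of s] s cseminorm_commute[OF CS_cseminorm[OF q(1)], of "F z"] by auto
  have "F z \<in> D"
  proof (rule domain_of_holomorphy_disc[OF D z(2), of "\<lambda>\<zeta>. F (cline (cline z u (of_real s)) w \<zeta>)" q])
    show "lcc (cball 0 \<delta>) (\<lambda>\<zeta>. F (cline (cline z u (of_real s)) w \<zeta>))"
      by (intro contF_cline continuous_intros) (use inU s in auto)
    show "(\<lambda>\<zeta>. \<phi> (F (cline (cline z u (of_real s)) w \<zeta>))) holomorphic_on ball 0 \<delta>"
      if "\<phi> \<in> dual_space sc P" for \<phi>
      by (rule slice_holomorphic[OF that]) (use inU s in auto)
    show "y \<in> D" if "cmod \<zeta> = \<delta>" "q (y - F (cline (cline z u (of_real s)) w \<zeta>)) < 1" for \<zeta> y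
      using q(2)[of "(s, \<zeta>)" y] that s by (simp add: K_def \<kappa>_def)
  qed (use inD s q(1) close in auto)
  then show False using z(1) by (simp add: E_def)
qed

text \<open>Along discs tending to an extremal point of the level set \<open>F = F x\<close>, the function
\<open>1 / (\<phi> \<circ> F - \<phi> (F x))\<close> would have to be bounded by its values on the boundary circles.\<close>

lemma image_subset_frontier_image:
  assumes \<phi>: "\<phi> \<in> dual_space sc P" and inj: "\<And>y y'. \<phi> y = \<phi> y' \<Longrightarrow> y = y'" and x: "x \<in> U"
  shows "F x \<in> F ` frontier U"
proof (rule ccontr)
  assume no: "F x \<notin> F ` frontier U"
  define h where "h = (\<lambda>w. \<phi> (F w) - \<phi> (F x))"
  have h0: "h w = 0 \<longleftrightarrow> F w = F x" for w using inj by (auto simp: h_def)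
  have ch: "continuous_on (closure U) h"
    unfolding h_def by (intro continuous_intros lcc_dual[OF contF \<phi>])
  define E where "E = {w \<in> closure U. h w = 0}"
  have "closed E" unfolding E_def by (intro continuous_closed_preimage_constant ch closed_closure)
  then have cE: "compact E"
    using bU bounded_subset[OF bounded_closure[OF bU], of E] by (auto simp: E_def compact_eq_bounded_closed)
  have EU: "E \<subseteq> U"
  proof
    fix w assume "w \<in> E"
    then have "w \<in> U \<union> frontier U" "F w = F x" using closure_eq by (auto simp: E_def h0)
    then show "w \<in> U" using no by (metis UnE imageI)
  qed
  have "x \<in> E" using x closure_subset by (auto simp: E_def h0)
  then have Ene: "E \<noteq> {}" by blast
  obtain z u w \<delta> where z: "z \<in> E" "\<delta> > 0"
    and inU_all: "\<forall>s \<zeta>. 0 \<le> s \<longrightarrow> s \<le> \<delta> \<longrightarrow> cmod \<zeta> \<le> \<delta> \<longrightarrow> cline (cline z u (of_real s)) w \<zeta> \<in> U"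
    and notE_all: "\<forall>s \<zeta>. 0 \<le> s \<longrightarrow> s \<noteq> 0 \<or> \<zeta> \<noteq> 0 \<longrightarrow> cline (cline z u (of_real s)) w \<zeta> \<notin> E"
    by (rule discs_approaching_compact[OF cE Ene oU EU])
  note inU = inU_all[rule_format] and notE = notE_all[rule_format]
  have hn0: "h (cline (cline z u (of_real s)) w \<zeta>) \<noteq> 0"
    if "0 \<le> s" "s \<le> \<delta>" "cmod \<zeta> \<le> \<delta>" "s \<noteq> 0 \<or> \<zeta> \<noteq> 0" for s \<zeta>
    using inU[OF that(1-3)] notE[OF that(1,4)] closure_subset by (auto simp: E_def)
  have ch': "continuous_on S (\<lambda>x. h (cline (f x) v (g x)))"
    if "continuous_on S f" "continuous_on S g" "\<And>x. x \<in> S \<Longrightarrow> cline (f x) v (g x) \<in> U"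
    for S :: "'d::metric_space set" and f v g
  proof (rule continuous_on_compose2[OF ch continuous_on_cline[OF that(1,2)]])
    show "(\<lambda>x. cline (f x) v (g x)) ` S \<subseteq> closure U" using that(3) closure_subset by blast
  qed
  \<comment> \<open>The compact union of circles includes the one at \<open>s = 0\<close>, so the
    minimum of \<open>cmod h\<close> on it is positive and serves every s.\<close>
  define K where "K = {0..\<delta>} \<times> sphere (0::complex) \<delta>"
  have K: "compact K" unfolding K_def by (intro compact_Times) auto
  have "(0, of_real \<delta>) \<in> K" using z(2) by (simp add: K_def)
  then have "K \<noteq> {}" by blast
  moreover have "continuous_on K (\<lambda>p. cmod (h (cline (cline z u (of_real (fst p))) w (snd p))))"
    by (intro ch' continuous_intros) (use inU in \<open>auto simp: K_def\<close>)
  ultimately obtain p0 where p0: "p0 \<in> K" "\<And>p. p \<in> K \<Longrightarrow>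
      cmod (h (cline (cline z u (of_real (fst p0))) w (snd p0))) \<le> cmod (h (cline (cline z u (of_real (fst p))) w (snd p)))"
    using continuous_attains_inf[OF K] by blast
  define m where "m = cmod (h (cline (cline z u (of_real (fst p0))) w (snd p0)))"
  have m: "m > 0" using hn0[of "fst p0" "snd p0"] p0(1) z(2) by (auto simp: m_def K_def)
  have lower: "m \<le> cmod (h (cline z u (of_real s)))" if s: "0 < s" "s \<le> \<delta>" for s
  proof -
    let ?g = "\<lambda>\<zeta>. inverse (h (cline (cline z u (of_real s)) w \<zeta>))"
    have "cmod (?g 0) \<le> inverse m"
    proof (rule maximum_modulus_frontier[where S = "cball 0 \<delta>" and f = ?g])
      have "(\<lambda>\<zeta>. h (cline (cline z u (of_real s)) w \<zeta>)) holomorphic_on ball 0 \<delta>"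
        unfolding h_def by (intro holomorphic_intros slice_holomorphic[OF \<phi>]) (use inU s in auto)
      then show "?g holomorphic_on interior (cball 0 \<delta>)"
        unfolding interior_cball using hn0 s by (intro holomorphic_on_inverse) auto
      have "continuous_on (cball 0 \<delta>) ?g"
        by (intro continuous_on_inverse ch' continuous_intros) (use inU hn0 s in auto)
      then show "continuous_on (closure (cball 0 \<delta>)) ?g" by simp
      show "cmod (?g \<zeta>) \<le> inverse m" if "\<zeta> \<in> frontier (cball 0 \<delta>)" for \<zeta>
        using p0(2)[of "(s, \<zeta>)"] that s m
        by (auto simp: m_def K_def norm_inverse intro!: le_imp_inverse_le)
    qed (use z(2) in auto)
    moreover have "h (cline z u (of_real s)) \<noteq> 0" using hn0[of s 0] s z(2) by simp
    ultimately show ?thesis using m by (simp add: norm_inverse)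
  qed
  \<comment> \<open>As s tends to 0 the centre tends to z, where \<open>h\<close> vanishes, against
    the lower bound m.\<close>
  have "continuous_on {0..\<delta>} (\<lambda>s. h (cline z u (of_real s)))"
    by (intro ch' continuous_intros) (use inU[of _ 0] z(2) in auto)
  then obtain d where d: "d > 0"
    "\<And>s. s \<in> {0..\<delta>} \<Longrightarrow> dist s 0 < d \<Longrightarrow> dist (h (cline z u (of_real s))) (h (cline z u (of_real 0))) < m"
    unfolding continuous_on_iff using m z(2)
    by (metis atLeastAtMost_iff less_imp_le order_refl)
  define s where "s = min (d/2) \<delta>"
  have "0 < s" "s \<le> \<delta>" "s < d" using d(1) z(2) by (auto simp: s_def)
  then show False using lower[of s] d(2)[of s] z(1) by (simp add: E_def)
qed

end

text \<open>The Hausdorff property gives a seminorm, hence a continuous functional, not vanishing at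
  a basis vector; on a one-dimensional space such a functional is injective.\<close>

lemma functional_separating_points_dim_1:
  assumes "dim (UNIV :: 'a set) = 1"
  obtains \<phi> where "\<phi> \<in> dual_space sc P" "\<And>y y'. \<phi> y = \<phi> y' \<Longrightarrow> y = y'"
proof -
  obtain B where B: "independent B" "UNIV \<subseteq> span B" "card B = 1"
    using basis_exists[of UNIV] assms by auto
  then obtain b where b: "B = {b}" by (auto simp: card_1_singleton_iff)
  have "b \<noteq> 0" using B(1) b dependent_zero by blast
  then obtain q where q: "CS q" "q b \<ge> 1" by (rule CS_separating)
  obtain \<phi> where \<phi>: "\<phi> \<in> dual_space sc P" "q b \<le> cmod (\<phi> b)"
    using norming_functional[OF q(1), of b] by blast
  have "\<phi> b \<noteq> 0" using \<phi>(2) q(2) by auto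
  moreover have "\<exists>k. y = sc k b" for y
    using B(2) unfolding b span_singleton by blast
  ultimately have "y = y'" if "\<phi> y = \<phi> y'" for y y'
    using that by (metis dual_scale[OF \<phi>(1)] mult_cancel_right)
  then show ?thesis using that \<phi>(1) by blast
qed

text \<open>The set where \<open>q <= c\<close> is convex and closed. Working with q directly, a
  point of the closure is matched up to e by a convex combination.\<close>

lemma CS_le_on_closed_hull:
  assumes q: "CS q" and y: "y \<in> T closure_of (cconv_hull sc B)" and B: "\<And>b. b \<in> B \<Longrightarrow> q b \<le> c"
  shows "q y \<le> c"
proof (rule field_le_epsilon)
  fix e :: real assume e: "e > 0"
  have "CS (\<lambda>y. (1/e) * q y)" using e by (intro CS_mult q) simp
  then obtain k where k: "k \<in> cconv_hull sc B" "(1/e) * q (k - y) < 1"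
    using y unfolding in_closure_iff by blast
  then obtain n :: nat and t b where tb: "\<forall>i<n. 0 \<le> t i \<and> b i \<in> B" "(\<Sum>i<n. t i) = (1::real)"
    "k = (\<Sum>i<n. sc (of_real (t i)) (b i))"
    unfolding cconv_hull_def by blast
  note cs = CS_cseminorm[OF q]
  have sum_le: "q (\<Sum>i\<in>I. g i) \<le> (\<Sum>i\<in>I. q (g i))" if "finite I" for g and I :: "nat set"
    using that
  proof (induction I rule: finite_induct)
    case (insert i I)
    then show ?case using cseminorm_triangle[OF cs, of "g i" "\<Sum>i\<in>I. g i"] by simp
  qed (simp add: cseminorm_zero[OF cs])
  have "q k \<le> (\<Sum>i<n. t i * q (b i))"
    using sum_le[of "{..<n}" "\<lambda>i. sc (of_real (t i)) (b i)"] tb(1)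
    by (simp add: tb(3) cseminorm_scale[OF cs])
  also have "\<dots> \<le> (\<Sum>i<n. t i * c)"
    using tb(1) B by (intro sum_mono mult_left_mono) auto
  also have "\<dots> = c" using tb(2) by (simp add: sum_distrib_right[symmetric])
  finally have "q k \<le> c" .
  moreover have "q (k - y) < e" using k(2) e by (simp add: field_simps)
  ultimately show "q y \<le> c + e" using cseminorm_diff_ge[OF cs, of k y] by simp
qed

end

section \<open>Transfer to X\<close>

lemma sc_lc_spaceI:
  assumes "seq_complete_hausdorff_lcs sc P"
  shows "sc_lc_space sc P"
proof -
  have Y: "vector_space sc" "\<forall>p\<in>P. cseminorm sc p" "Hausdorff_space (lc_topology P)"
    and comp: "\<forall>s :: nat \<Rightarrow> 'a. (\<forall>p\<in>P. \<forall>e>0. \<exists>N. \<forall>m\<ge>N. \<forall>n\<ge>N. p (s m - s n) < e)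
        \<longrightarrow> (\<exists>y. limitin (lc_topology P) s y sequentially)"
    using assms unfolding seq_complete_hausdorff_lcs_def by auto
  interpret vector_space sc by (rule Y(1))
  show ?thesis
  proof unfold_locales
    show "cseminorm sc p" if "p \<in> P" for p using Y(2) that by blast
    show "Hausdorff_space (lc_topology P)" by (rule Y(3))
    show "\<exists>y. limitin (lc_topology P) s y sequentially"
      if "\<And>p e. p \<in> P \<Longrightarrow> e > 0 \<Longrightarrow> \<exists>N. \<forall>m\<ge>N. \<forall>n\<ge>N. p (s m - s n) < e" for s :: "nat \<Rightarrow> 'a"
      by (rule comp[rule_format]) (rule that)
  qed
qed

lemma par2_cline:
  assumes "vector_space scX"
  shows "par2 scX a v1 v2 (cline w v z) = par2 scX a v1 v2 w + scX z (par2 scX 0 v1 v2 v)"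
proof -
  interpret vector_space scX by fact
  show ?thesis by (simp add: par2_def cline_def scale_left_distrib scale_right_distrib algebra_simps)
qed

theorem mainTheorem12:
  fixes scX :: "complex \<Rightarrow> 'x::ab_group_add \<Rightarrow> 'x"
    and scY :: "complex \<Rightarrow> 'y::ab_group_add \<Rightarrow> 'y"
    and P :: "('y \<Rightarrow> real) set"
    and \<Omega> :: "'x set"
    and f :: "'x \<Rightarrow> 'y"
  assumes X: "vector_space scX"
    and dimX: "\<exists>v1 v2. cindep2 scX v1 v2"
    and Y: "seq_complete_hausdorff_lcs scY P"
    and Ynz: "\<exists>y::'y. y \<noteq> 0"
    and open1: "one_open scX \<Omega>"
    and planes: "\<forall>x\<in>\<Omega>. \<exists>a v1 v2. cindep2 scX v1 v2 \<and> x \<in> range (par2 scX a v1 v2) \<and>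
                   bounded (par2 scX a v1 v2 -` \<Omega>) \<and> open (par2 scX a v1 v2 -` \<Omega>)"
    and fHG: "f \<in> HG_maps scX scY P \<Omega>"
    and fC2: "f \<in> C2_maps scX P (\<Omega> \<union> bd2 scX \<Omega>)"
  shows "sqsub scY P (f ` \<Omega>) (f ` bd2 scX \<Omega>) \<and>
         (\<forall>p. cont_seminorm scY P p \<longrightarrow>
           (SUP x\<in>\<Omega>. ereal (p (f x))) = (SUP x\<in>bd2 scX \<Omega>. ereal (p (f x)))) \<and>
         (\<forall>D. domain_of_holomorphy scY P D \<longrightarrow> f ` bd2 scX \<Omega> \<subseteq> D \<longrightarrow> f ` \<Omega> \<subseteq> D)"
proof -
  interpret Y: sc_lc_space scY P by (rule sc_lc_spaceI[OF Y])
  let ?B = "f ` bd2 scX \<Omega>"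
  have frontier_bd2: "par2 scX a v1 v2 w \<in> bd2 scX \<Omega>"
    if "cindep2 scX v1 v2" "w \<in> frontier (par2 scX a v1 v2 -` \<Omega>)" for a v1 v2 w
    unfolding bd2_def using that by auto
  \<comment> \<open>Boundary points of the trace lie in \<open>bd2\<close> by its definition, so the
    closure stays where f is continuous.\<close>
  have cont: "Y.lcc (closure (par2 scX a v1 v2 -` \<Omega>)) (f \<circ> par2 scX a v1 v2)"
    if v: "cindep2 scX v1 v2" for a v1 v2
  proof (rule Y.lcc_subset)
    show "Y.lcc (par2 scX a v1 v2 -` (\<Omega> \<union> bd2 scX \<Omega>)) (f \<circ> par2 scX a v1 v2)"
      using fC2 v unfolding C2_maps_def by blast
    show "closure (par2 scX a v1 v2 -` \<Omega>) \<subseteq> par2 scX a v1 v2 -` (\<Omega> \<union> bd2 scX \<Omega>)"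
      unfolding closure_Un_frontier using frontier_bd2[OF v] by auto
  qed
  \<comment> \<open>The facts about one plane, stated without its parametrisation; each inclusion
    for f on \<Omega> is then a lemma on \<open>U\<close> and \<open>F\<close>.\<close>
  have plane: "\<exists>U F w. open U \<and> bounded U \<and> Y.lcc (closure U) F \<and>
      (\<forall>w v \<phi>. w \<in> U \<longrightarrow> \<phi> \<in> dual_space scY P \<longrightarrow>
         (\<exists>r>0. (\<lambda>z. \<phi> (F (cline w v z))) holomorphic_on ball 0 r)) \<and>
      w \<in> U \<and> F w = f x \<and> F ` frontier U \<subseteq> ?B" if x: "x \<in> \<Omega>" for x
  proof -
    obtain a v1 v2 where v: "cindep2 scX v1 v2" "x \<in> range (par2 scX a v1 v2)"
      "bounded (par2 scX a v1 v2 -` \<Omega>)" "open (par2 scX a v1 v2 -` \<Omega>)"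
      using planes x by blast
    define U where "U = par2 scX a v1 v2 -` \<Omega>"
    define F where "F = f \<circ> par2 scX a v1 v2"
    obtain w where w: "x = par2 scX a v1 v2 w" using v(2) by blast
    have hol: "\<exists>r>0. (\<lambda>z. \<phi> (F (cline w v z))) holomorphic_on ball 0 r"
      if "w \<in> U" "\<phi> \<in> dual_space scY P" for w v \<phi>
    proof -
      have "par2 scX a v1 v2 w \<in> \<Omega>" using that(1) by (simp add: U_def)
      then show ?thesis
        using fHG that(2) unfolding HG_maps_def F_def o_def par2_cline[OF X] by blast
    qed
    have "F ` frontier U \<subseteq> ?B" using frontier_bd2[OF v(1)] by (auto simp: F_def U_def)
    then show ?thesis
      using v(3,4) hol cont[OF v(1), of a] x w
      by (intro exI[of _ U] exI[of _ F] exI[of _ w]) (auto simp: U_def F_def)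
  qed
  have hull: "f x \<in> Y.T closure_of (cconv_hull scY ?B)" if x: "x \<in> \<Omega>" for x
  proof -
    obtain U F w where U: "open U" "bounded U" "Y.lcc (closure U) F"
      "\<forall>w v \<phi>. w \<in> U \<longrightarrow> \<phi> \<in> dual_space scY P \<longrightarrow>
         (\<exists>r>0. (\<lambda>z. \<phi> (F (cline w v z))) holomorphic_on ball 0 r)"
      and w: "w \<in> U" "F w = f x" "F ` frontier U \<subseteq> ?B"
      using plane[OF x] by blast
    have "F w \<in> Y.T closure_of (cconv_hull scY (F ` frontier U))"
      by (rule Y.in_closed_hull_frontier[OF U(1-3) U(4)[rule_format] w(1)])
    then show ?thesis
      using closure_of_mono[OF Y.cconv_hull_mono[OF w(3)]] w(2) by auto
  qed
  have hull_fin: "f x \<in> cconv_hull scY ?B" if x: "x \<in> \<Omega>" and fd: "fin_dim scY" for x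
  proof -
    obtain U F w where U: "open U" "bounded U" "Y.lcc (closure U) F"
      "\<forall>w v \<phi>. w \<in> U \<longrightarrow> \<phi> \<in> dual_space scY P \<longrightarrow>
         (\<exists>r>0. (\<lambda>z. \<phi> (F (cline w v z))) holomorphic_on ball 0 r)"
      and w: "w \<in> U" "F w = f x" "F ` frontier U \<subseteq> ?B"
      using plane[OF x] by blast
    have "F w \<in> Y.T closure_of (cconv_hull scY (F ` frontier U))"
      by (rule Y.in_closed_hull_frontier[OF U(1-3) U(4)[rule_format] w(1)])
    \<comment> \<open>Closedness is used for the hull of the compact image of this one boundary; the
      full image \<open>?B\<close> is brought in only afterwards, by monotonicity.\<close>
    moreover have "Y.lcc (frontier U) F" by (rule Y.lcc_subset[OF U(3)]) (simp add: frontier_def)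
    ultimately have "F w \<in> cconv_hull scY (F ` frontier U)"
      using Y.closed_cconv_hull_compact_image[OF fd compact_frontier_bounded[OF U(2)]] by simp
    then show ?thesis using Y.cconv_hull_mono[OF w(3)] w(2) by auto
  qed
  have dim1: "f x \<in> ?B" if x: "x \<in> \<Omega>" and dim: "vector_space.dim scY (UNIV :: 'y set) = 1" for x
  proof -
    obtain U F w where U: "open U" "bounded U" "Y.lcc (closure U) F"
      "\<forall>w v \<phi>. w \<in> U \<longrightarrow> \<phi> \<in> dual_space scY P \<longrightarrow>
         (\<exists>r>0. (\<lambda>z. \<phi> (F (cline w v z))) holomorphic_on ball 0 r)"
      and w: "w \<in> U" "F w = f x" "F ` frontier U \<subseteq> ?B"
      using plane[OF x] by blast
    obtain \<phi> where \<phi>: "\<phi> \<in> dual_space scY P" "\<forall>y y'. \<phi> y = \<phi> y' \<longrightarrow> y = y'"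
      using Y.functional_separating_points_dim_1[OF dim] by metis
    have "F w \<in> F ` frontier U"
      by (rule Y.image_subset_frontier_image[OF U(1-3) U(4)[rule_format] \<phi>(1) \<phi>(2)[rule_format] w(1)])
    then show ?thesis using w by auto
  qed
  have dom: "f x \<in> D" if x: "x \<in> \<Omega>" and D: "domain_of_holomorphy scY P D" "?B \<subseteq> D" for x D
  proof -
    obtain U F w where U: "open U" "bounded U" "Y.lcc (closure U) F"
      "\<forall>w v \<phi>. w \<in> U \<longrightarrow> \<phi> \<in> dual_space scY P \<longrightarrow>
         (\<exists>r>0. (\<lambda>z. \<phi> (F (cline w v z))) holomorphic_on ball 0 r)"
      and w: "w \<in> U" "F w = f x" "F ` frontier U \<subseteq> ?B"
      using plane[OF x] by blast
    have "F w \<in> D"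
      by (rule Y.image_subset_domain_of_holomorphy[OF U(1-3) U(4)[rule_format] D(1) _ w(1)])
         (use w(3) D(2) in auto)
    then show ?thesis using w(2) by simp
  qed
  have sup: "(SUP x\<in>\<Omega>. ereal (p (f x))) = (SUP x\<in>bd2 scX \<Omega>. ereal (p (f x)))"
    if p: "cont_seminorm scY P p" for p
  proof (rule antisym)
    have le: "p (f x) \<le> c" if "x \<in> \<Omega>" "\<And>b. b \<in> bd2 scX \<Omega> \<Longrightarrow> p (f b) \<le> c" for x c
      by (rule Y.CS_le_on_closed_hull[OF p hull[OF that(1)]]) (use that(2) in auto)
    \<comment> \<open>The reverse inequality is continuity alone: a point of \<open>bd2\<close> is a
      limit, within its plane, of points of \<Omega>.\<close>
    have ge: "p (f b) \<le> c" if b: "b \<in> bd2 scX \<Omega>" and c: "\<And>x. x \<in> \<Omega> \<Longrightarrow> p (f x) \<le> c" for b c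
    proof -
      obtain a v1 v2 w where v: "cindep2 scX v1 v2" and w: "w \<in> frontier (par2 scX a v1 v2 -` \<Omega>)"
        "b = par2 scX a v1 v2 w"
        using b unfolding bd2_def by auto
      have "p ((f \<circ> par2 scX a v1 v2) w) \<le> c"
      proof (rule continuous_le_on_closure[where S = "par2 scX a v1 v2 -` \<Omega>"])
        show "continuous_on (closure (par2 scX a v1 v2 -` \<Omega>)) (\<lambda>w. p ((f \<circ> par2 scX a v1 v2) w))"
          by (rule Y.lcc_CS[OF cont[OF v] p])
      qed (use w c in \<open>auto simp: frontier_def\<close>)
      then show ?thesis by (simp add: w(2))
    qed
    \<comment> \<open>Both inequalities follow from comparing real upper bounds; a supremum of
      \<infinity> on the right is trivial.\<close>
    have ereal_le: "(SUP x\<in>A. ereal (p (f x))) \<le> (SUP x\<in>B. ereal (p (f x)))"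
      if AB: "\<And>x c. x \<in> A \<Longrightarrow> (\<And>b. b \<in> B \<Longrightarrow> p (f b) \<le> c) \<Longrightarrow> p (f x) \<le> c" for A B
    proof (rule SUP_least)
      fix x assume x: "x \<in> A"
      show "ereal (p (f x)) \<le> (SUP x\<in>B. ereal (p (f x)))"
      proof (cases "SUP x\<in>B. ereal (p (f x))")
        case (real c)
        have "p (f b) \<le> c" if "b \<in> B" for b
          using SUP_upper[OF that, of "\<lambda>x. ereal (p (f x))"] real by simp
        then show ?thesis using AB[OF x] real by simp
      next
        \<comment> \<open>A supremum of real values is -\<infinity> only over the empty set; any
          bound then holds vacuously, and the bound -1 contradicts the non-negativity of p.\<close>
        case MInf
        have "B = {}"
        proof (rule ccontr)
          assume "B \<noteq> {}"
          then obtain b where "b \<in> B" by blast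
          from SUP_upper[OF this, of "\<lambda>x. ereal (p (f x))"] show False using MInf by simp
        qed
        then have "p (f x) \<le> - 1" using AB[OF x, of "-1"] by simp
        then show ?thesis using Y.cseminorm_nonneg[OF Y.CS_cseminorm[OF p], of "f x"] by simp
      qed simp
    qed
    show "(SUP x\<in>\<Omega>. ereal (p (f x))) \<le> (SUP x\<in>bd2 scX \<Omega>. ereal (p (f x)))"
      by (rule ereal_le) (rule le)
    show "(SUP x\<in>bd2 scX \<Omega>. ereal (p (f x))) \<le> (SUP x\<in>\<Omega>. ereal (p (f x)))"
      by (rule ereal_le) (rule ge)
  qed
  have "sqsub scY P (f ` \<Omega>) ?B"
    unfolding sqsub_def using hull hull_fin dim1 by auto
  then show ?thesis using sup dom by blast
qed

end
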